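(* Let $\mathcal{G}$ be a Brauer graph and $A_{\mathcal{G}}=\Bbbk Q_{\mathcal{G}}/I_{\mathcal{G}}$ its corresponding Brauer graph algebra. Then the following statements are equivalent. (1) $A_{\mathcal{G}}$ is a UMP algebra. (2) The underlying graph of $\mathcal{G}$ is either a single edge joining two distinct vertices (with no other vertices or edges), or a single vertex with a single loop. (3) The quiver $Q_{\mathcal{G}}$ and the ideal $I_{\mathcal{G}}$ are given by one of the following four cases: (a) $Q_0=\{0\}$ and $Q_1=\emptyset$; in this case $A_{\mathcal{G}}\cong\Bbbk$. (b) $Q_{\mathcal{G}}$ has one vertex $0$ and one loop $\alpha$, and $I_{\mathcal{G}}=\langle\alpha^{m+1}\rangle$ with $m\in\mathbb{Z}^+$; in this case $A_{\mathcal{G}}\cong\Bbbk[x]/\langle x^{m+1}\rangle$. (c) $Q_{\mathcal{G}}$ has one vertex $0$ and two loops $\alpha,\beta$, and $I_{\mathcal{G}}=\langle\alpha^m-\beta^n,\alpha\beta,\beta\alpha\rangle$, where $m,n\in\mathbb{Z}_{\geq2}$; in this case $A_{\mathcal{G}}\cong\Bbbk\langle x,y\rangle/\langle xy,yx,x^m-y^n\rangle$. (d) $Q_{\mathcal{G}}$ has one vertex $0$ and two loops $\alpha,\beta$, and $I_{\mathcal{G}}=\langle(\alpha\beta)^m-(\beta\alpha)^m,\alpha^2,\beta^2\rangle$, where $m\in\mathbb{Z}^+$; in this case $A_{\mathcal{G}}\cong\Bbbk\langle x,y\rangle/\langle x^2,y^2,(xy)^m-(yx)^m\rangle$.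
   Context: Brauer graphs. A Brauer graph is $\mathcal G=(V,E,m,\mathfrak o)$ where: $(V,E)$ is a finite connected graph (loops and multiple edges allowed, at least one edge); $val(v)$ is the number of half-edges incident to $v\in V$; $m:V\to\mathbb Z^+$ is the multiplicity function; a vertex $v$ is truncated if $val(v)m(v)=1$; $V^*$ is the set of non-truncated vertices; $\mathfrak o$ assigns to each $v\in V^*$ a cyclic order $i_0<i_1<\cdots<i_{val(v)-1}<i_0$ on the half-edges incident to $v$ (so a loop at $v$ appears twice; if $val(v)=1$ the order is $i<i$). The next element in the cyclic order is called the successor. The half-edges of an edge $i$ are written $\widehat i$ and $\widetilde i$. Brauer graph algebra. $\Bbbk$ is an algebraically closed field. $A_{\mathcal G}=\Bbbk Q_{\mathcal G}/I_{\mathcal G}$, where $Q_{\mathcal G}=(Q_0,Q_1,s,t)$ has vertex set $Q_0=E$ and, for each $v\in V^*$ and each half-edge at $v$, one arrow from the corresponding edge $i$ to the edge $j$ of its successor in the cyclic order at $v$. For $v\in V^*$ and a half-edge $\widehat i$ of $i$ incident to $v$, the successor sequence of $v$ starting at $\widehat i$ gives a cyclic path $A_{v,\widehat i}=\alpha_0\cdots\alpha_{val(v)-1}$ starting at $i$, called a special $v$-cycle. $w^{(p)}$ denotes the $p$-th power of a cyclic path $w$. $I_{\mathcal G}$ is generated by: (I) $A_{v,\widehat i}^{(m(v))}-A_{v',\widetilde i}^{(m(v'))}$, where $i$ is an edge linking non-truncated vertices $v,v'$ and $\widehat i,\widetilde i$ are its half-edges incident to $v$ and $v'$ respectively; (II)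 $A_{v,\widehat i}^{(m(v))}A_{v,\widehat i}^0$, where $v\in V^*$, $\widehat i$ is a half-edge at $v$ and $A_{v,\widehat i}^0$ is the first arrow of $A_{v,\widehat i}$; (III) $\alpha\beta$, for arrows $\alpha,\beta$ such that $\alpha\beta$ is not a subpath of any special cycle, except if $\alpha=\beta$ is a loop corresponding to a non-truncated vertex $v$ with $val(v)=1$. UMP. For a bound quiver algebra $A=\Bbbk Q/I$ and a path $\mathfrak m$ in $Q$, $\mathfrak m+I$ is a maximal path of $A$ if $\mathfrak m\notin I$ and $\alpha\mathfrak m\in I$, $\mathfrak m\alpha\in I$ for every arrow $\alpha\in Q_1$ (non-composable products are $0$). $A$ is a UMP algebra if every arrow extends to a unique maximal path, i.e. for every arrow $a$ there is exactly one maximal path $\mathfrak m+I$ having a representative path of which $a$ is a subpath. In (3), the descriptions of $(Q_{\mathcal G},I_{\mathcal G})$ are up to naming of the vertex and arrows. *)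

theory Defs
  imports
    "Graph_Theory.Digraph_Component"
    "HOL-Algebra.QuotRing"
    "HOL-Algebra.Module"
    "HOL-Combinatorics.Orbits"
    "HOL-Computational_Algebra.Polynomial"
    "HOL-Library.Poly_Mapping"
    "HOL-Library.Sublist"
begin

section \<open>Algebras over a field, quotients and isomorphisms\<close>

text \<open>
  An algebra over the field \<open>'k\<close> is a ring record with scalar multiplication. The record type
  \<^typ>\<open>('k, 'b) module\<close> is used only as a signature: the locale \<^locale>\<open>module\<close>
  concerns modules over commutative rings given by a carrier and plays no role here.
\<close>

definition quotient_algebra :: "('k, 'b) module \<Rightarrow> 'b set \<Rightarrow> ('k, 'b set) module" where
  "quotient_algebra A I =
    \<lparr>carrier = carrier (A Quot I), mult = mult (A Quot I), one = one (A Quot I),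
     zero = zero (A Quot I), add = add (A Quot I),
     module.smult = (\<lambda>c X. \<Union>x\<in>X. I +>\<^bsub>A\<^esub> (c \<odot>\<^bsub>A\<^esub> x))\<rparr>"

definition algebra_isomorphic :: "('k, 'b) module \<Rightarrow> ('k, 'c) module \<Rightarrow> bool" where
  "algebra_isomorphic A B \<longleftrightarrow>
    (\<exists>h\<in>ring_iso A B. \<forall>c. \<forall>x\<in>carrier A. h (c \<odot>\<^bsub>A\<^esub> x) = c \<odot>\<^bsub>B\<^esub> h x)"

definition base_algebra :: "('k :: field, 'k) module" where
  "base_algebra =
    \<lparr>carrier = UNIV, mult = (*), one = 1, zero = 0, add = (+), module.smult = (*)\<rparr>"

definition polynomial_algebra :: "('k :: field, 'k poly) module" where
  "polynomial_algebra =
    \<lparr>carrier = UNIV, mult = (*), one = 1, zero = 0, add = (+), module.smult = Polynomial.smult\<rparr>"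

abbreviation basis_elt :: "'b \<Rightarrow> ('b \<Rightarrow>\<^sub>0 'k :: field)" where
  "basis_elt p \<equiv> Poly_Mapping.single p 1"

abbreviation scale :: "'k :: field \<Rightarrow> ('b \<Rightarrow>\<^sub>0 'k) \<Rightarrow> ('b \<Rightarrow>\<^sub>0 'k)" where
  "scale c \<equiv> Poly_Mapping.map ((*) c)"

definition bilinear_ext ::
    "('b \<Rightarrow> 'b \<Rightarrow> ('b \<Rightarrow>\<^sub>0 'k)) \<Rightarrow> ('b \<Rightarrow>\<^sub>0 'k :: field) \<Rightarrow> ('b \<Rightarrow>\<^sub>0 'k) \<Rightarrow> ('b \<Rightarrow>\<^sub>0 'k)" where
  "bilinear_ext \<mu> f g =
    (\<Sum>p\<in>Poly_Mapping.keys f. \<Sum>q\<in>Poly_Mapping.keys g.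
      scale (Poly_Mapping.lookup f p * Poly_Mapping.lookup g q) (\<mu> p q))"

text \<open>The free algebra on the letters of type \<open>'x\<close>, with the words as basis.\<close>

definition free_algebra :: "('k :: field, 'x list \<Rightarrow>\<^sub>0 'k) module" where
  "free_algebra =
    \<lparr>carrier = UNIV, mult = bilinear_ext (\<lambda>u w. basis_elt (u @ w)),
     one = basis_elt [], zero = 0, add = (+), module.smult = scale\<rparr>"

datatype letter = X | Y

definition list_power :: "nat \<Rightarrow> 'a list \<Rightarrow> 'a list" where
  "list_power n w = concat (replicate n w)"

section \<open>Path algebras of quivers\<close>

text \<open>
  A quiver is a directed multigraph. A path is given by its source and its list of arrows, in the
  order in which they are traversed: \<open>\<alpha>\<beta>\<close> means first \<open>\<alpha>\<close>, then \<open>\<beta>\<close>.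
\<close>

type_synonym ('v, 'a) path = "'v \<times> 'a list"

definition paths :: "('v, 'a) pre_digraph \<Rightarrow> ('v, 'a) path set" where
  "paths Q = {(u, p) | u p. \<exists>v. pre_digraph.awalk Q u p v}"

definition path_prod ::
    "('v, 'a) pre_digraph \<Rightarrow> ('v, 'a) path \<Rightarrow> ('v, 'a) path \<Rightarrow> (('v, 'a) path \<Rightarrow>\<^sub>0 'k :: field)" where
  "path_prod Q p q =
    (if pre_digraph.awalk Q (fst p) (snd p) (fst q)
     then basis_elt (fst p, snd p @ snd q) else 0)"

definition path_algebra ::
    "('v, 'a) pre_digraph \<Rightarrow> ('k :: field, ('v, 'a) path \<Rightarrow>\<^sub>0 'k) module" where
  "path_algebra Q =
    \<lparr>carrier = {f. Poly_Mapping.keys f \<subseteq> paths Q},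
     mult = bilinear_ext (path_prod Q),
     one = (\<Sum>v\<in>verts Q. basis_elt (v, [])), zero = 0, add = (+), module.smult = scale\<rparr>"

definition is_rose :: "('v, 'a) pre_digraph \<Rightarrow> 'v \<Rightarrow> 'a set \<Rightarrow> bool" where
  "is_rose Q z L \<longleftrightarrow> verts Q = {z} \<and> arcs Q = L \<and> (\<forall>a\<in>L. tail Q a = z \<and> head Q a = z)"

definition arrow_elt ::
    "('v, 'a) pre_digraph \<Rightarrow> 'a \<Rightarrow> (('v, 'a) path \<Rightarrow>\<^sub>0 'k :: field)" where
  "arrow_elt Q a = basis_elt (tail Q a, [a])"

section \<open>Maximal paths and UMP algebras\<close>

definition maximal_paths ::
    "('v, 'a) pre_digraph \<Rightarrow> (('v, 'a) path \<Rightarrow>\<^sub>0 'k :: field) set \<Rightarrow> (('v, 'a) path \<Rightarrow>\<^sub>0 'k) set set" where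
  "maximal_paths Q I =
    {I +>\<^bsub>path_algebra Q\<^esub> basis_elt p | p.
      p \<in> paths Q \<and> basis_elt p \<notin> I \<and>
      (\<forall>a\<in>arcs Q. arrow_elt Q a \<otimes>\<^bsub>path_algebra Q\<^esub> basis_elt p \<in> I \<and>
                   basis_elt p \<otimes>\<^bsub>path_algebra Q\<^esub> arrow_elt Q a \<in> I)}"

definition UMP ::
    "('v, 'a) pre_digraph \<Rightarrow> (('v, 'a) path \<Rightarrow>\<^sub>0 'k :: field) set \<Rightarrow> bool" where
  "UMP Q I \<longleftrightarrow>
    (\<forall>a\<in>arcs Q. \<exists>!M. M \<in> maximal_paths Q I \<and>
      (\<exists>p\<in>paths Q. M = I +>\<^bsub>path_algebra Q\<^esub> basis_elt p \<and> sublist [a] (snd p)))"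

section \<open>Brauer graphs\<close>

text \<open>
  The underlying undirected multigraph is presented by a directed one; the direction of an edge
  serves only to name its two half-edges \<open>(i, False)\<close> (at the tail) and \<open>(i, True)\<close> (at the head).
  The cyclic order at a non-truncated vertex \<open>v\<close> is given by its successor function
  \<open>succ_at \<G> v\<close>, which has to permute the half-edges at \<open>v\<close> in a single cycle. Its values at
  truncated vertices and outside of the half-edges at \<open>v\<close> are irrelevant.
\<close>

type_synonym 'e half_edge = "'e \<times> bool"

record ('v, 'e) brauer_graph =
  graph :: "('v, 'e) pre_digraph"
  multiplicity_at :: "'v \<Rightarrow> nat"
  succ_at :: "'v \<Rightarrow> 'e half_edge \<Rightarrow> 'e half_edge"

definition endpoint :: "('v, 'e) brauer_graph \<Rightarrow> 'e half_edge \<Rightarrow> 'v" where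
  "endpoint \<G> h = (if snd h then head (graph \<G>) (fst h) else tail (graph \<G>) (fst h))"

definition half_edges :: "('v, 'e) brauer_graph \<Rightarrow> 'e half_edge set" where
  "half_edges \<G> = arcs (graph \<G>) \<times> UNIV"

definition half_edges_at :: "('v, 'e) brauer_graph \<Rightarrow> 'v \<Rightarrow> 'e half_edge set" where
  "half_edges_at \<G> v = {h \<in> half_edges \<G>. endpoint \<G> h = v}"

definition val :: "('v, 'e) brauer_graph \<Rightarrow> 'v \<Rightarrow> nat" where
  "val \<G> v = card (half_edges_at \<G> v)"

definition truncated :: "('v, 'e) brauer_graph \<Rightarrow> 'v \<Rightarrow> bool" where
  "truncated \<G> v \<longleftrightarrow> val \<G> v * multiplicity_at \<G> v = 1"

definition nontruncated_verts :: "('v, 'e) brauer_graph \<Rightarrow> 'v set" where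
  "nontruncated_verts \<G> = {v \<in> verts (graph \<G>). \<not> truncated \<G> v}"

definition is_brauer_graph :: "('v, 'e) brauer_graph \<Rightarrow> bool" where
  "is_brauer_graph \<G> \<longleftrightarrow>
    fin_digraph (graph \<G>) \<and> connected (graph \<G>) \<and> arcs (graph \<G>) \<noteq> {} \<and>
    (\<forall>v\<in>verts (graph \<G>). multiplicity_at \<G> v > 0) \<and>
    (\<forall>v\<in>nontruncated_verts \<G>. cyclic_on (succ_at \<G> v) (half_edges_at \<G> v))"

definition is_single_edge :: "('v, 'e) pre_digraph \<Rightarrow> bool" where
  "is_single_edge G \<longleftrightarrow>
    (\<exists>u v i. u \<noteq> v \<and> verts G = {u, v} \<and> arcs G = {i} \<and> {tail G i, head G i} = {u, v})"

definition is_single_loop :: "('v, 'e) pre_digraph \<Rightarrow> bool" where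
  "is_single_loop G \<longleftrightarrow>
    (\<exists>v i. verts G = {v} \<and> arcs G = {i} \<and> tail G i = v \<and> head G i = v)"

section \<open>The quiver and the ideal of a Brauer graph\<close>

definition succ_half :: "('v, 'e) brauer_graph \<Rightarrow> 'e half_edge \<Rightarrow> 'e half_edge" where
  "succ_half \<G> h = succ_at \<G> (endpoint \<G> h) h"

text \<open>The arrow belonging to a half-edge at a non-truncated vertex is that half-edge itself.\<close>

definition brauer_quiver :: "('v, 'e) brauer_graph \<Rightarrow> ('e, 'e half_edge) pre_digraph" where
  "brauer_quiver \<G> =
    \<lparr>verts = arcs (graph \<G>),
     arcs = {h \<in> half_edges \<G>. endpoint \<G> h \<in> nontruncated_verts \<G>},
     tail = fst,
     head = (\<lambda>h. fst (succ_half \<G> h))\<rparr>"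

text \<open>The arrows of the special \<open>v\<close>-cycle starting at the half-edge \<open>h\<close>, where \<open>v\<close> is the endpoint of \<open>h\<close>.\<close>

definition special_cycle :: "('v, 'e) brauer_graph \<Rightarrow> 'e half_edge \<Rightarrow> 'e half_edge list" where
  "special_cycle \<G> h = map (\<lambda>k. (succ_half \<G> ^^ k) h) [0..<val \<G> (endpoint \<G> h)]"

definition special_power :: "('v, 'e) brauer_graph \<Rightarrow> 'e half_edge \<Rightarrow> 'e half_edge list" where
  "special_power \<G> h = list_power (multiplicity_at \<G> (endpoint \<G> h)) (special_cycle \<G> h)"

definition relations_I ::
    "('v, 'e) brauer_graph \<Rightarrow> (('e, 'e half_edge) path \<Rightarrow>\<^sub>0 'k :: field) set" where
  "relations_I \<G> =
    {basis_elt (i, special_power \<G> (i, b)) - basis_elt (i, special_power \<G> (i, \<not> b)) | i b.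
      i \<in> arcs (graph \<G>) \<and> endpoint \<G> (i, b) \<in> nontruncated_verts \<G> \<and>
      endpoint \<G> (i, \<not> b) \<in> nontruncated_verts \<G>}"

definition relations_II ::
    "('v, 'e) brauer_graph \<Rightarrow> (('e, 'e half_edge) path \<Rightarrow>\<^sub>0 'k :: field) set" where
  "relations_II \<G> =
    {basis_elt (fst h, special_power \<G> h @ [hd (special_cycle \<G> h)]) | h.
      h \<in> half_edges \<G> \<and> endpoint \<G> h \<in> nontruncated_verts \<G>}"

definition relations_III ::
    "('v, 'e) brauer_graph \<Rightarrow> (('e, 'e half_edge) path \<Rightarrow>\<^sub>0 'k :: field) set" where
  "relations_III \<G> =
    {basis_elt (fst a, [a, b]) | a b.
      (fst a, [a, b]) \<in> paths (brauer_quiver \<G>) \<and>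
      \<not> (\<exists>h\<in>half_edges \<G>. endpoint \<G> h \<in> nontruncated_verts \<G> \<and>
            sublist [a, b] (special_cycle \<G> h)) \<and>
      \<not> (a = b \<and> val \<G> (endpoint \<G> a) = 1)}"

definition brauer_ideal ::
    "('v, 'e) brauer_graph \<Rightarrow> (('e, 'e half_edge) path \<Rightarrow>\<^sub>0 'k :: field) set" where
  "brauer_ideal \<G> =
    Idl\<^bsub>path_algebra (brauer_quiver \<G>)\<^esub> (relations_I \<G> \<union> relations_II \<G> \<union> relations_III \<G>)"

end

theory Submission
  imports Defs
begin

text \<open>
  The linear functional that sums the coefficients of the special powers starting at a fixed edge
  vanishes on the Brauer graph ideal. Hence special powers are nonzero in the algebra, and two of
  them can only be congruent if they start at the same edge. A path outside of the ideal is a prefix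
  of a special power, so the maximal paths are exactly the classes of the special powers. The special
  powers starting at the half-edges of a vertex \<open>v\<close> all contain all arrows at \<open>v\<close>. So if the algebra
  is UMP, then the half-edges at each vertex belong to one edge, and by connectedness there is only
  one edge. Conversely, for a graph with one edge all special powers are congruent by relation (I).
  The quiver of such a graph is a rose with at most two loops, whose path algebra is the ground
  field, a polynomial ring or a free algebra on two letters; the presentations follow since
  relation (II) is redundant when there are two loops.
\<close>

section \<open>Algebras with a basis\<close>

text \<open>The obstacle is non-membership: the relations show which elements lie in the ideal,
  never which do not, and computing a basis of the quotient would be laborious. A linear functional
  only has to be tested on products p s q of a relation s with two paths. The test succeeds because
  all half-edges in a special power have the same endpoint, so the special powers starting at any of
  them have the same length \<open>turns\<close>. Hence no special power is a proper subpath of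
  another one. Relation (I) contributes two special powers at one edge with opposite signs, which is
  why the functional adds up coefficients over both half-edges of an edge; fixing the edge is what
  later separates special powers of different edges. Truncated vertices carry no arrows, so the UMP
  condition says nothing about them; they have a single half-edge, and this fills the gap when one
  walks through the graph. The presentations in the four cases are compared with the full list of
  relations by testing against an arbitrary ideal, and are then transported along explicit
  isomorphisms of path algebras.\<close>

declare Poly_Mapping.map_single [simp del]

lemma lookup_scale [simp]: "Poly_Mapping.lookup (scale c f) p = c * Poly_Mapping.lookup f p"
  by (transfer) (simp add: when_def)

lemma scale_add_right: "scale c (f + g) = scale c f + scale c g"
  by (rule poly_mapping_eqI) (simp add: lookup_add distrib_left)

lemma scale_add_left: "scale (c + d) f = scale c f + scale d f"
  by (rule poly_mapping_eqI) (simp add: lookup_add distrib_right)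

lemma scale_scale: "scale c (scale d f) = scale (c * d) f"
  by (rule poly_mapping_eqI) (simp add: mult.assoc)

lemma scale_zero_left [simp]: "scale 0 f = 0"
  by (rule poly_mapping_eqI) simp

lemma scale_zero_right [simp]: "scale c 0 = 0"
  by (rule poly_mapping_eqI) simp

lemma scale_one [simp]: "scale 1 f = f"
  by (rule poly_mapping_eqI) simp

lemma scale_minus_one: "scale (- 1) f = - f"
  by (rule poly_mapping_eqI) simp

lemma scale_sum: "scale c (sum f A) = (\<Sum>x\<in>A. scale c (f x))"
  by (induction A rule: infinite_finite_induct) (simp_all add: scale_add_right)

lemma keys_scale: "Poly_Mapping.keys (scale c f) \<subseteq> Poly_Mapping.keys f"
  by (auto simp: in_keys_iff)

lemma sum_basis_elt:
  assumes "finite A" "Poly_Mapping.keys f \<subseteq> A"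
  shows "f = (\<Sum>p\<in>A. scale (Poly_Mapping.lookup f p) (basis_elt p))"
proof (rule poly_mapping_eqI)
  fix k
  have "(\<Sum>p\<in>A. Poly_Mapping.lookup f p * Poly_Mapping.lookup (basis_elt p) k)
      = (\<Sum>p\<in>A. if p = k then Poly_Mapping.lookup f k else 0)"
    by (rule sum.cong) (auto simp: lookup_single)
  also have "\<dots> = Poly_Mapping.lookup f k"
    using assms by (auto simp: sum.delta in_keys_iff)
  finally show "Poly_Mapping.lookup f k
      = Poly_Mapping.lookup (\<Sum>p\<in>A. scale (Poly_Mapping.lookup f p) (basis_elt p)) k"
    by (simp add: lookup_sum)
qed

text \<open>Reduces every linear statement to basis elements. The induction runs over finite sets of
  keys, and the partial sums keep their support in \<open>B\<close>, so that closure properties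
  relative to \<open>B\<close> are available in the \<open>add\<close> case.\<close>

lemma basis_induct [consumes 1, case_names zero scale add]:
  assumes f: "Poly_Mapping.keys f \<subseteq> B"
    and zero: "P 0"
    and scale: "\<And>c p. p \<in> B \<Longrightarrow> P (scale c (basis_elt p))"
    and add: "\<And>f g. \<lbrakk>Poly_Mapping.keys f \<subseteq> B; Poly_Mapping.keys g \<subseteq> B; P f; P g\<rbrakk> \<Longrightarrow> P (f + g)"
  shows "P f"
proof -
  define T where "T A = (\<Sum>p\<in>A. scale (Poly_Mapping.lookup f p) (basis_elt p))" for A
  have "Poly_Mapping.keys (T A) \<subseteq> B \<and> P (T A)" if "finite A" "A \<subseteq> B" for A
    using that
  proof (induction A rule: finite_induct)
    case empty
    then show ?case by (simp add: T_def zero)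
  next
    case (insert x A)
    have k: "Poly_Mapping.keys (scale (Poly_Mapping.lookup f x) (basis_elt x)) \<subseteq> B"
      using insert.prems keys_scale[of "Poly_Mapping.lookup f x" "basis_elt x"] by auto
    have T: "T (insert x A) = scale (Poly_Mapping.lookup f x) (basis_elt x) + T A"
      using insert.hyps by (simp add: T_def)
    show ?case
      unfolding T using insert k keys_add[of "scale (Poly_Mapping.lookup f x) (basis_elt x)" "T A"]
      by (auto intro!: add scale)
  qed
  from this[OF finite_keys f] show ?thesis
    using sum_basis_elt[OF finite_keys order_refl, of f] by (simp add: T_def)
qed

text \<open>\<open>bilinear_ext\<close> sums over exact supports, which may shrink by cancellation
  in a sum. Common larger index sets make the terms of different products comparable; the extra
  terms vanish.\<close>

lemma bilinear_ext_superset: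
  assumes "finite A" "Poly_Mapping.keys f \<subseteq> A" "finite B" "Poly_Mapping.keys g \<subseteq> B"
  shows "bilinear_ext \<mu> f g = (\<Sum>p\<in>A. \<Sum>q\<in>B.
    scale (Poly_Mapping.lookup f p * Poly_Mapping.lookup g q) (\<mu> p q))"
proof -
  have "bilinear_ext \<mu> f g = (\<Sum>p\<in>Poly_Mapping.keys f. \<Sum>q\<in>B.
    scale (Poly_Mapping.lookup f p * Poly_Mapping.lookup g q) (\<mu> p q))"
    unfolding bilinear_ext_def
    by (intro sum.cong refl sum.mono_neutral_left) (use assms in \<open>auto simp: in_keys_iff\<close>)
  also have "\<dots> = (\<Sum>p\<in>A. \<Sum>q\<in>B.
    scale (Poly_Mapping.lookup f p * Poly_Mapping.lookup g q) (\<mu> p q))"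
    by (intro sum.mono_neutral_left) (use assms in \<open>auto simp: in_keys_iff\<close>)
  finally show ?thesis .
qed

lemma bilinear_ext_add_left: "bilinear_ext \<mu> (f + f') g = bilinear_ext \<mu> f g + bilinear_ext \<mu> f' g"
proof -
  let ?A = "Poly_Mapping.keys f \<union> Poly_Mapping.keys f'"
  note * = bilinear_ext_superset[of ?A _ "Poly_Mapping.keys g" g \<mu>]
  show ?thesis
    using keys_add[of f f']
    by (subst (1 2 3) *) (auto simp: lookup_add distrib_right scale_add_left sum.distrib)
qed

lemma bilinear_ext_add_right: "bilinear_ext \<mu> f (g + g') = bilinear_ext \<mu> f g + bilinear_ext \<mu> f g'"
proof -
  let ?A = "Poly_Mapping.keys g \<union> Poly_Mapping.keys g'"
  note * = bilinear_ext_superset[of "Poly_Mapping.keys f" f ?A _ \<mu>]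
  show ?thesis
    using keys_add[of g g']
    by (subst (1 2 3) *) (auto simp: lookup_add distrib_left scale_add_left sum.distrib)
qed

lemma bilinear_ext_scale_left: "bilinear_ext \<mu> (scale c f) g = scale c (bilinear_ext \<mu> f g)"
  using keys_scale[of c f]
  by (subst bilinear_ext_superset[of "Poly_Mapping.keys f" _ "Poly_Mapping.keys g"])
     (auto simp: bilinear_ext_def scale_sum scale_scale mult.assoc)

lemma bilinear_ext_scale_right: "bilinear_ext \<mu> f (scale c g) = scale c (bilinear_ext \<mu> f g)"
  using keys_scale[of c g]
  by (subst bilinear_ext_superset[of "Poly_Mapping.keys f" _ "Poly_Mapping.keys g"])
     (auto simp: bilinear_ext_def scale_sum scale_scale ac_simps)

lemma bilinear_ext_diff_left: "bilinear_ext \<mu> (f - f') g = bilinear_ext \<mu> f g - bilinear_ext \<mu> f' g"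
  using bilinear_ext_add_left[of \<mu> "f - f'" f' g] by simp

lemma bilinear_ext_diff_right: "bilinear_ext \<mu> f (g - g') = bilinear_ext \<mu> f g - bilinear_ext \<mu> f g'"
  using bilinear_ext_add_right[of \<mu> f "g - g'" g'] by simp

lemma bilinear_ext_zero_left [simp]: "bilinear_ext \<mu> 0 g = 0"
  by (simp add: bilinear_ext_def)

lemma bilinear_ext_zero_right [simp]: "bilinear_ext \<mu> f 0 = 0"
  by (simp add: bilinear_ext_def)

lemma bilinear_ext_basis [simp]: "bilinear_ext \<mu> (basis_elt p) (basis_elt q) = \<mu> p q"
  by (simp add: bilinear_ext_def)

lemma bilinear_ext_sum_left: "bilinear_ext \<mu> (sum f A) g = (\<Sum>x\<in>A. bilinear_ext \<mu> (f x) g)"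
  by (induction A rule: infinite_finite_induct) (simp_all add: bilinear_ext_add_left)

lemma bilinear_ext_sum_right: "bilinear_ext \<mu> g (sum f A) = (\<Sum>x\<in>A. bilinear_ext \<mu> g (f x))"
  by (induction A rule: infinite_finite_induct) (simp_all add: bilinear_ext_add_right)

lemmas bilinear_ext_simps =
  bilinear_ext_add_left bilinear_ext_add_right bilinear_ext_scale_left bilinear_ext_scale_right

text \<open>Both sides are trilinear, so basis triples suffice; the arguments are freed one at a
  time, from right to left.\<close>

lemma bilinear_ext_assoc:
  assumes "\<And>p q r. bilinear_ext \<mu> (\<mu> p q) (basis_elt r) = bilinear_ext \<mu> (basis_elt p) (\<mu> q r)"
  shows "bilinear_ext \<mu> (bilinear_ext \<mu> f g) h = bilinear_ext \<mu> f (bilinear_ext \<mu> g h)"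
proof -
  have 1: "bilinear_ext \<mu> (bilinear_ext \<mu> (basis_elt p) (basis_elt q)) h
      = bilinear_ext \<mu> (basis_elt p) (bilinear_ext \<mu> (basis_elt q) h)" for p q
    using subset_UNIV[of "Poly_Mapping.keys h"]
    by (induction h rule: basis_induct) (simp_all add: bilinear_ext_simps assms)
  have 2: "bilinear_ext \<mu> (bilinear_ext \<mu> (basis_elt p) g) h
      = bilinear_ext \<mu> (basis_elt p) (bilinear_ext \<mu> g h)" for p
    using subset_UNIV[of "Poly_Mapping.keys g"]
    by (induction g rule: basis_induct)
       (simp_all add: bilinear_ext_simps 1 del: bilinear_ext_basis)
  show ?thesis
    using subset_UNIV[of "Poly_Mapping.keys f"]
    by (induction f rule: basis_induct)
       (simp_all add: bilinear_ext_simps 2 del: bilinear_ext_basis)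
qed

text \<open>Common frame for path algebras and free algebras. Associativity is demanded for all
  indices, also outside of \<open>B\<close>, so that it can be used without carrier conditions; for
  paths this is harmless since non-composable products are 0.\<close>

locale based_algebra =
  fixes A :: "('k :: field, 'b \<Rightarrow>\<^sub>0 'k) module" (structure)
    and B :: "'b set" and \<mu> :: "'b \<Rightarrow> 'b \<Rightarrow> ('b \<Rightarrow>\<^sub>0 'k)" and e :: "'b \<Rightarrow>\<^sub>0 'k"
  assumes A_def: "A = \<lparr>carrier = {f. Poly_Mapping.keys f \<subseteq> B}, mult = bilinear_ext \<mu>,
      one = e, zero = 0, add = (+), module.smult = scale\<rparr>"
    and assoc: "bilinear_ext \<mu> (\<mu> p q) (basis_elt r) = bilinear_ext \<mu> (basis_elt p) (\<mu> q r)"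
    and closed: "\<lbrakk>p \<in> B; q \<in> B\<rbrakk> \<Longrightarrow> Poly_Mapping.keys (\<mu> p q) \<subseteq> B"
    and unit_closed: "Poly_Mapping.keys e \<subseteq> B"
    and unit_left: "p \<in> B \<Longrightarrow> bilinear_ext \<mu> e (basis_elt p) = basis_elt p"
    and unit_right: "p \<in> B \<Longrightarrow> bilinear_ext \<mu> (basis_elt p) e = basis_elt p"
begin

lemma record_simps [simp]:
  "carrier A = {f. Poly_Mapping.keys f \<subseteq> B}" "x \<otimes> y = bilinear_ext \<mu> x y"
  "\<one> = e" "\<zero> = 0" "x \<oplus> y = x + y" "c \<odot> x = scale c x"
  by (simp_all add: A_def)

lemma scale_closed: "Poly_Mapping.keys f \<subseteq> B \<Longrightarrow> Poly_Mapping.keys (scale c f) \<subseteq> B"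
  by (rule order_trans[OF keys_scale])

lemma add_closed:
  "\<lbrakk>Poly_Mapping.keys f \<subseteq> B; Poly_Mapping.keys g \<subseteq> B\<rbrakk> \<Longrightarrow> Poly_Mapping.keys (f + g) \<subseteq> B"
  using keys_add[of f g] by auto

lemma mult_closed:
  assumes "Poly_Mapping.keys f \<subseteq> B" "Poly_Mapping.keys g \<subseteq> B"
  shows "Poly_Mapping.keys (bilinear_ext \<mu> f g) \<subseteq> B"
  using assms(1)
proof (induction f rule: basis_induct)
  case (scale c p)
  from assms(2) have "Poly_Mapping.keys (bilinear_ext \<mu> (basis_elt p) g) \<subseteq> B"
    by (induction g rule: basis_induct)
       (use scale in \<open>simp_all add: bilinear_ext_simps scale_closed closed add_closed\<close>)
  then show ?case by (simp add: bilinear_ext_simps scale_closed)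
qed (simp_all add: bilinear_ext_simps add_closed)

lemma mult_assoc: "bilinear_ext \<mu> (bilinear_ext \<mu> f g) h = bilinear_ext \<mu> f (bilinear_ext \<mu> g h)"
  by (rule bilinear_ext_assoc) (rule assoc)

lemma unit_left': "Poly_Mapping.keys f \<subseteq> B \<Longrightarrow> bilinear_ext \<mu> e f = f"
  by (induction f rule: basis_induct) (simp_all add: bilinear_ext_simps unit_left)

lemma unit_right': "Poly_Mapping.keys f \<subseteq> B \<Longrightarrow> bilinear_ext \<mu> f e = f"
  by (induction f rule: basis_induct) (simp_all add: bilinear_ext_simps unit_right)

sublocale ring A
proof (rule ringI)
  show "abelian_group A"
  proof (rule abelian_groupI)
    fix x assume "x \<in> carrier A"
    then show "\<exists>y\<in>carrier A. y \<oplus> x = \<zero>" by (intro bexI[of _ "- x"]) auto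
  qed (simp_all add: add_closed algebra_simps)
  show "Group.monoid A"
    by (rule monoidI) (simp_all add: mult_closed unit_closed mult_assoc unit_left' unit_right')
qed (simp_all add: bilinear_ext_simps)

lemma
  assumes "ideal I A"
  shows ideal_zero: "0 \<in> I"
    and ideal_add: "\<lbrakk>x \<in> I; y \<in> I\<rbrakk> \<Longrightarrow> x + y \<in> I"
    and ideal_mult_left: "\<lbrakk>x \<in> I; Poly_Mapping.keys y \<subseteq> B\<rbrakk> \<Longrightarrow> bilinear_ext \<mu> y x \<in> I"
    and ideal_mult_right: "\<lbrakk>x \<in> I; Poly_Mapping.keys y \<subseteq> B\<rbrakk> \<Longrightarrow> bilinear_ext \<mu> x y \<in> I"
    and ideal_scale: "x \<in> I \<Longrightarrow> scale c x \<in> I"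
    and ideal_diff: "\<lbrakk>x \<in> I; y \<in> I\<rbrakk> \<Longrightarrow> x - y \<in> I"
proof -
  interpret ideal I A by fact
  show "0 \<in> I" using zero_closed by simp
  show add: "x + y \<in> I" if "x \<in> I" "y \<in> I" for x y using a_closed[OF that] by simp
  show left: "bilinear_ext \<mu> y x \<in> I" if "x \<in> I" "Poly_Mapping.keys y \<subseteq> B" for x y
    using I_l_closed[of x y] that by simp
  show "bilinear_ext \<mu> x y \<in> I" if "x \<in> I" "Poly_Mapping.keys y \<subseteq> B" for x y
    using I_r_closed[of x y] that by simp
  have closed: "Poly_Mapping.keys x \<subseteq> B" if "x \<in> I" for x using Icarr[OF that] by simp
  \<comment> \<open>Scaling by c is left multiplication by c times the unit, so ring ideals are
    automatically subspaces.\<close>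
  show scale: "scale c x \<in> I" if "x \<in> I" for x c
    using left[OF that scale_closed[OF unit_closed, of c]] closed[OF that]
    by (simp add: bilinear_ext_simps unit_left')
  show "x - y \<in> I" if "x \<in> I" "y \<in> I" for x y
    using add[OF \<open>x \<in> I\<close> scale[OF \<open>y \<in> I\<close>, of "-1"]] by (simp add: scale_minus_one)
qed

text \<open>The elements x with \<phi>(f x g) = 0 for all f and g form a two-sided ideal inside the
  kernel of \<phi>. Bilinearity reduces the inclusion of \<open>S\<close> in it to basis elements on
  both sides; minimality of the generated ideal then gives the claim with f = g =
  \<open>e\<close>.\<close>

lemma functional_vanishes:
  assumes S: "S \<subseteq> carrier A"
    and \<phi>_add: "\<And>f g. \<phi> (f + g) = \<phi> f + \<phi> g"
    and \<phi>_scale: "\<And>c f. \<phi> (scale c f) = c * (\<phi> f :: 'k)"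
    and vanish: "\<And>p q s. \<lbrakk>p \<in> B; q \<in> B; s \<in> S\<rbrakk> \<Longrightarrow>
      \<phi> (bilinear_ext \<mu> (bilinear_ext \<mu> (basis_elt p) s) (basis_elt q)) = 0"
    and x: "x \<in> Idl S"
  shows "\<phi> x = 0"
proof -
  have \<phi>0: "\<phi> 0 = 0" using \<phi>_scale[of 0 0] by simp
  define J where "J = {x \<in> carrier A. \<forall>f g. Poly_Mapping.keys f \<subseteq> B \<longrightarrow> Poly_Mapping.keys g \<subseteq> B \<longrightarrow>
    \<phi> (bilinear_ext \<mu> (bilinear_ext \<mu> f x) g) = 0}"
  have neg: "- x \<in> J" if "x \<in> J" for x
    using that \<phi>_scale[of "-1"] unfolding J_def
    by (simp add: bilinear_ext_simps scale_closed flip: scale_minus_one)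
  have "ideal J A"
  proof (rule idealI)
    show "ring A" by (rule ring_axioms)
    show "subgroup J (add_monoid A)"
    proof (rule add.subgroupI)
      show "J \<subseteq> carrier A" by (auto simp: J_def)
      show "J \<noteq> {}" by (auto simp: J_def \<phi>0 intro!: exI[of _ 0])
      show "\<ominus> x \<in> J" if "x \<in> J" for x
      proof -
        have "x \<in> carrier A" using that by (auto simp: J_def)
        then have "\<ominus> x = - x"
          by (intro minus_equality) auto
        then show ?thesis using neg[OF that] by simp
      qed
      show "x \<oplus> y \<in> J" if "x \<in> J" "y \<in> J" for x y
        using that unfolding J_def by (auto simp: bilinear_ext_simps \<phi>_add add_closed)
    qed
    show "a \<otimes> x \<in> J" if "x \<in> J" "a \<in> carrier A" for x a
      using that unfolding J_def by (auto simp: mult_assoc[symmetric] mult_closed)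
    show "x \<otimes> a \<in> J" if "x \<in> J" "a \<in> carrier A" for x a
      using that unfolding J_def by (auto simp: mult_assoc mult_closed)
  qed
  moreover have "S \<subseteq> J"
  proof
    fix s assume s: "s \<in> S"
    have 1: "\<phi> (bilinear_ext \<mu> (bilinear_ext \<mu> (basis_elt p) s) g) = 0"
      if "p \<in> B" "Poly_Mapping.keys g \<subseteq> B" for p g
      using that(2)
      by (induction g rule: basis_induct)
         (use that s in \<open>simp_all add: bilinear_ext_simps \<phi>0 \<phi>_add \<phi>_scale vanish\<close>)
    have 2: "\<phi> (bilinear_ext \<mu> (bilinear_ext \<mu> f s) g) = 0"
      if "Poly_Mapping.keys f \<subseteq> B" "Poly_Mapping.keys g \<subseteq> B" for f g
      using that(1)
      by (induction f rule: basis_induct)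
         (use that s in \<open>simp_all add: bilinear_ext_simps \<phi>0 \<phi>_add \<phi>_scale 1\<close>)
    then show "s \<in> J" using s S by (auto simp: J_def)
  qed
  ultimately have "Idl S \<subseteq> J" by (rule genideal_minimal)
  then have "\<phi> (bilinear_ext \<mu> (bilinear_ext \<mu> e x) e) = 0" "Poly_Mapping.keys x \<subseteq> B"
    using x by (auto simp: J_def unit_closed)
  then show ?thesis by (simp add: unit_left' unit_right')
qed

end

section \<open>Quotient algebras\<close>

text \<open>The image of an ideal under an isomorphism is its preimage under the inverse, and
  preimages of ideals are ideals.\<close>

lemma ideal_iso_image:
  assumes h: "h \<in> ring_iso A B" and "ring A" "ring B" and I: "ideal I A"
  shows "ideal (h ` I) B"
proof -
  interpret A: ring A by fact
  interpret B: ring B by fact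
  let ?g = "inv_into (carrier A) h"
  have bij: "bij_betw h (carrier A) (carrier B)" using h by (simp add: ring_iso_def)
  have g: "?g \<in> ring_iso B A" by (rule ring_iso_set_sym[OF assms(2) h])
  interpret ring_hom_ring B A ?g
    using g by (intro ring_hom_ringI2) (auto simp: ring_iso_def A.ring_axioms B.ring_axioms)
  have IA: "I \<subseteq> carrier A" using ideal.Icarr[OF I] by blast
  have "h ` I = {r \<in> carrier B. ?g r \<in> I}"
  proof (intro equalityI subsetI)
    fix y assume "y \<in> h ` I"
    then show "y \<in> {r \<in> carrier B. ?g r \<in> I}"
      using IA bij by (auto simp: bij_betw_def inv_into_f_f subset_iff)
  next
    fix y assume "y \<in> {r \<in> carrier B. ?g r \<in> I}"
    then have "h (?g y) = y" "?g y \<in> I"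
      using bij f_inv_into_f[of y h "carrier A"] by (simp_all add: bij_betw_def)
    then show "y \<in> h ` I" by (metis imageI)
  qed
  then show ?thesis using ideal_vimage[OF I] by simp
qed

text \<open>Minimality of the generated ideal is used twice: in \<open>B\<close> against the image
  of an ideal, in \<open>A\<close> against the preimage of one.\<close>

lemma genideal_iso_image:
  assumes h: "h \<in> ring_iso A B" and "ring A" "ring B" and S: "S \<subseteq> carrier A"
  shows "h ` (Idl\<^bsub>A\<^esub> S) = Idl\<^bsub>B\<^esub> (h ` S)"
proof
  interpret A: ring A by fact
  interpret B: ring B by fact
  interpret ring_hom_ring A B h
    using h by (intro ring_hom_ringI2) (auto simp: ring_iso_def A.ring_axioms B.ring_axioms)
  have hS: "h ` S \<subseteq> carrier B" using S by auto
  show "Idl\<^bsub>B\<^esub> (h ` S) \<subseteq> h ` (Idl\<^bsub>A\<^esub> S)"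
    using A.genideal_self[OF S] by (intro B.genideal_minimal ideal_iso_image[OF assms(1-3)] A.genideal_ideal S) auto
  have "Idl\<^bsub>A\<^esub> S \<subseteq> {r \<in> carrier A. h r \<in> Idl\<^bsub>B\<^esub> (h ` S)}"
    using B.genideal_self[OF hS] S by (intro A.genideal_minimal ideal_vimage B.genideal_ideal hS) auto
  then show "h ` (Idl\<^bsub>A\<^esub> S) \<subseteq> Idl\<^bsub>B\<^esub> (h ` S)" by auto
qed

lemma quotient_algebra_simps:
  "carrier (quotient_algebra A I) = (\<lambda>x. I +>\<^bsub>A\<^esub> x) ` carrier A"
  "mult (quotient_algebra A I) = rcoset_mult A I"
  "one (quotient_algebra A I) = I +>\<^bsub>A\<^esub> \<one>\<^bsub>A\<^esub>"
  "zero (quotient_algebra A I) = I"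
  "add (quotient_algebra A I) = (<+>\<^bsub>A\<^esub>)"
  "module.smult (quotient_algebra A I) c U = (\<Union>x\<in>U. I +>\<^bsub>A\<^esub> (c \<odot>\<^bsub>A\<^esub> x))"
  by (auto simp: quotient_algebra_def FactRing_def A_RCOSETS_def')

lemma a_r_coset_hom_image:
  assumes h: "h \<in> ring_hom A B" and "I \<subseteq> carrier A" "x \<in> carrier A"
  shows "h ` (I +>\<^bsub>A\<^esub> x) = h ` I +>\<^bsub>B\<^esub> h x"
  using assms ring_hom_add[OF h] by (auto simp: a_r_coset_def' subset_iff image_iff)

text \<open>The isomorphism takes images of cosets as sets. It sends the coset of x to the coset of
  h x, is injective because h is, and respects the scalar action because that action is a union of
  cosets.\<close>

lemma quotient_algebra_isomorphic:
  assumes h: "h \<in> ring_iso A B" and A: "ring A" and B: "ring B" and I: "ideal I A"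
    and closed: "\<And>c x. x \<in> carrier A \<Longrightarrow> c \<odot>\<^bsub>A\<^esub> x \<in> carrier A"
    and smult: "\<And>c x. x \<in> carrier A \<Longrightarrow> h (c \<odot>\<^bsub>A\<^esub> x) = c \<odot>\<^bsub>B\<^esub> h x"
  shows "algebra_isomorphic (quotient_algebra A I) (quotient_algebra B (h ` I))"
proof -
  interpret I: ideal I A by (rule I)
  interpret J: ideal "h ` I" B by (rule ideal_iso_image[OF h A B I])
  have hh: "h \<in> ring_hom A B" and bij: "bij_betw h (carrier A) (carrier B)"
    using h by (auto simp: ring_iso_def)
  have IA: "I \<subseteq> carrier A" using I.Icarr by blast
  note coset = a_r_coset_hom_image[OF hh IA]
  have hc: "h x \<in> carrier B" if "x \<in> carrier A" for x using that bij by (auto simp: bij_betw_def)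
  have sub: "I +>\<^bsub>A\<^esub> x \<subseteq> carrier A" if "x \<in> carrier A" for x
    using that IA by (simp add: I.a_r_coset_subset_G)
  have hA: "h ` carrier A = carrier B" using bij by (simp add: bij_betw_def)
  have inj: "inj_on ((`) h) (carrier (quotient_algebra A I))"
    using bij sub by (auto simp: quotient_algebra_simps bij_betw_def inj_on_def inj_on_image_eq_iff)
  have "carrier (quotient_algebra B (h ` I)) = (`) h ` carrier (quotient_algebra A I)"
    unfolding quotient_algebra_simps hA[symmetric] image_image
    by (rule image_cong) (simp_all add: coset)
  with inj have bijq: "bij_betw ((`) h) (carrier (quotient_algebra A I)) (carrier (quotient_algebra B (h ` I)))"
    by (simp add: bij_betw_def)
  have "(`) h \<in> ring_hom (quotient_algebra A I) (quotient_algebra B (h ` I))"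
  proof (rule ring_hom_memI)
    fix U assume U: "U \<in> carrier (quotient_algebra A I)"
    then show "h ` U \<in> carrier (quotient_algebra B (h ` I))"
      using bijq by (auto simp: bij_betw_def)
    fix W assume W: "W \<in> carrier (quotient_algebra A I)"
    from U W obtain x y where xy: "U = I +>\<^bsub>A\<^esub> x" "W = I +>\<^bsub>A\<^esub> y" "x \<in> carrier A" "y \<in> carrier A"
      by (auto simp: quotient_algebra_simps)
    then show "h ` (U \<otimes>\<^bsub>quotient_algebra A I\<^esub> W) = h ` U \<otimes>\<^bsub>quotient_algebra B (h ` I)\<^esub> h ` W"
      by (simp add: quotient_algebra_simps coset I.rcoset_mult_add J.rcoset_mult_add hc ring_hom_mult[OF hh])
    from xy show "h ` (U \<oplus>\<^bsub>quotient_algebra A I\<^esub> W) = h ` U \<oplus>\<^bsub>quotient_algebra B (h ` I)\<^esub> h ` W"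
      by (simp add: quotient_algebra_simps coset I.a_rcos_sum J.a_rcos_sum hc ring_hom_add[OF hh])
  next
    show "h ` \<one>\<^bsub>quotient_algebra A I\<^esub> = \<one>\<^bsub>quotient_algebra B (h ` I)\<^esub>"
      by (simp add: quotient_algebra_simps coset ring_hom_one[OF hh])
  qed
  moreover have "h ` (c \<odot>\<^bsub>quotient_algebra A I\<^esub> U) = c \<odot>\<^bsub>quotient_algebra B (h ` I)\<^esub> (h ` U)"
    if "U \<in> carrier (quotient_algebra A I)" for c U
  proof -
    have "U \<subseteq> carrier A" using that sub by (auto simp: quotient_algebra_simps)
    then have "h ` (I +>\<^bsub>A\<^esub> c \<odot>\<^bsub>A\<^esub> x) = h ` I +>\<^bsub>B\<^esub> c \<odot>\<^bsub>B\<^esub> h x" if "x \<in> U" for x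
      using that by (auto simp: coset closed smult subset_iff)
    then show ?thesis by (simp add: quotient_algebra_simps image_UN)
  qed
  ultimately show ?thesis
    using bijq unfolding algebra_isomorphic_def ring_iso_def by (intro bexI[of _ "(`) h"]) simp_all
qed

text \<open>Serves the case whose target is the ground field itself and not a quotient. Cosets of
  the zero ideal are singletons, so \<open>the_elem\<close> removes them.\<close>

lemma quotient_algebra_zero_isomorphic:
  assumes h: "h \<in> ring_iso A B" and A: "ring A"
    and closed: "\<And>c x. x \<in> carrier A \<Longrightarrow> c \<odot>\<^bsub>A\<^esub> x \<in> carrier A"
    and smult: "\<And>c x. x \<in> carrier A \<Longrightarrow> h (c \<odot>\<^bsub>A\<^esub> x) = c \<odot>\<^bsub>B\<^esub> h x"
  shows "algebra_isomorphic (quotient_algebra A {\<zero>\<^bsub>A\<^esub>}) B"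
proof -
  interpret A: ring A by (rule A)
  interpret I: ideal "{\<zero>\<^bsub>A\<^esub>}" A by (rule A.zeroideal)
  have hh: "h \<in> ring_hom A B" and bij: "bij_betw h (carrier A) (carrier B)"
    using h by (auto simp: ring_iso_def)
  have coset: "{\<zero>\<^bsub>A\<^esub>} +>\<^bsub>A\<^esub> x = {x}" if "x \<in> carrier A" for x
    using that by (auto simp: a_r_coset_def')
  let ?Q = "quotient_algebra A {\<zero>\<^bsub>A\<^esub>}" and ?H = "\<lambda>U. h (the_elem U)"
  have car: "carrier ?Q = (\<lambda>x. {x}) ` carrier A"
    using coset by (auto simp: quotient_algebra_simps)
  have "?H \<in> ring_hom ?Q B"
  proof (rule ring_hom_memI)
    fix U assume "U \<in> carrier ?Q"
    then obtain x where x: "U = {x}" "x \<in> carrier A" by (auto simp: car)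
    then show "?H U \<in> carrier B" using ring_hom_closed[OF hh] by simp
    fix W assume "W \<in> carrier ?Q"
    then obtain y where y: "W = {y}" "y \<in> carrier A" by (auto simp: car)
    show "?H (U \<otimes>\<^bsub>?Q\<^esub> W) = ?H U \<otimes>\<^bsub>B\<^esub> ?H W"
      using x y I.rcoset_mult_add[of x y] by (simp add: quotient_algebra_simps coset ring_hom_mult[OF hh])
    show "?H (U \<oplus>\<^bsub>?Q\<^esub> W) = ?H U \<oplus>\<^bsub>B\<^esub> ?H W"
      using x y I.a_rcos_sum[of x y] by (simp add: quotient_algebra_simps coset ring_hom_add[OF hh])
  next
    show "?H \<one>\<^bsub>?Q\<^esub> = \<one>\<^bsub>B\<^esub>" by (simp add: quotient_algebra_simps coset ring_hom_one[OF hh])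
  qed
  moreover have "bij_betw ?H (carrier ?Q) (carrier B)"
    using bij by (auto simp: car bij_betw_def inj_on_def image_image)
  moreover have "?H (c \<odot>\<^bsub>?Q\<^esub> U) = c \<odot>\<^bsub>B\<^esub> ?H U" if "U \<in> carrier ?Q" for c U
    using that by (auto simp: car quotient_algebra_simps coset closed smult)
  ultimately show ?thesis
    unfolding algebra_isomorphic_def ring_iso_def by (intro bexI[of _ ?H]) simp_all
qed

section \<open>Path algebras\<close>

context wf_digraph
begin

lemma awalk_append_iff':
  assumes "awalk u p v"
  shows "awalk u (p @ q) w \<longleftrightarrow> awalk v q w"
proof -
  have "awlast u p = v" using assms by (rule awalkE)
  with assms show ?thesis by simp
qed

text \<open>Finiteness of the vertex set makes the sum of the trivial paths a genuine unit:
  multiplied with a path, only the trivial path at its source (on the left) or at its target (on the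
  right) survives.\<close>

lemma based_algebra_path_algebra:
  assumes "finite (verts G)"
  shows "based_algebra (path_algebra G :: ('k :: field, _) module) (paths G) (path_prod G)
    (\<Sum>v\<in>verts G. basis_elt (v, []))"
proof
  show "path_algebra G = \<lparr>carrier = {f. Poly_Mapping.keys f \<subseteq> paths G},
     mult = bilinear_ext (path_prod G),
     one = (\<Sum>v\<in>verts G. basis_elt (v, [])), zero = 0, add = (+), module.smult = scale\<rparr>"
    by (rule path_algebra_def)
  fix p q r :: "'a \<times> 'b list"
  show "bilinear_ext (path_prod G) (path_prod G p q) (basis_elt r)
      = (bilinear_ext (path_prod G) (basis_elt p) (path_prod G q r) :: _ \<Rightarrow>\<^sub>0 'k)"
    by (auto simp: path_prod_def awalk_append_iff' awalk_Nil_iff simp del: awalk_append_iff)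
  show "Poly_Mapping.keys (path_prod G p q :: _ \<Rightarrow>\<^sub>0 'k) \<subseteq> paths G" if "p \<in> paths G" "q \<in> paths G"
  proof -
    have "\<exists>w. awalk u (x @ y) w" if "awalk u x v" "awalk v y w" for u x v y w
      using that by (auto simp: awalk_append_iff' simp del: awalk_append_iff)
    then show ?thesis
      using that by (cases p; cases q) (auto simp: path_prod_def paths_def simp del: awalk_append_iff)
  qed
  show "Poly_Mapping.keys (\<Sum>v\<in>verts G. basis_elt (v, []) :: _ \<Rightarrow>\<^sub>0 'k) \<subseteq> paths G"
    by (rule order_trans[OF keys_sum]) (auto simp: paths_def awalk_Nil_iff)
  assume "p \<in> paths G"
  then obtain u w v where p: "p = (u, w)" "awalk u w v" by (auto simp: paths_def)
  have "bilinear_ext (path_prod G) (\<Sum>v\<in>verts G. basis_elt (v, [])) (basis_elt p :: _ \<Rightarrow>\<^sub>0 'k)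
      = (\<Sum>v\<in>verts G. if v = u then basis_elt p else 0)"
    unfolding bilinear_ext_sum_left by (rule sum.cong) (auto simp: path_prod_def p awalk_Nil_iff)
  then show "bilinear_ext (path_prod G) (\<Sum>v\<in>verts G. basis_elt (v, [])) (basis_elt p :: _ \<Rightarrow>\<^sub>0 'k)
      = basis_elt p"
    using assms awalk_hd_in_verts[OF p(2)] by (simp add: sum.delta)
  have "awalk u w x \<longleftrightarrow> x = v" for x
    using p(2) by (auto dest: awalk_ends)
  then have "bilinear_ext (path_prod G) (basis_elt p :: _ \<Rightarrow>\<^sub>0 'k) (\<Sum>v\<in>verts G. basis_elt (v, []))
      = (\<Sum>x\<in>verts G. if x = v then basis_elt p else 0)"
    unfolding bilinear_ext_sum_right by (intro sum.cong) (auto simp: path_prod_def p)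
  then show "bilinear_ext (path_prod G) (basis_elt p :: _ \<Rightarrow>\<^sub>0 'k) (\<Sum>v\<in>verts G. basis_elt (v, []))
      = basis_elt p"
    using assms awalk_last_in_verts[OF p(2)] by (simp add: sum.delta)
qed

end

lemma based_algebra_free_algebra:
  "based_algebra (free_algebra :: ('k :: field, _) module) UNIV (\<lambda>u w. basis_elt (u @ w)) (basis_elt [])"
  by unfold_locales (simp_all add: free_algebra_def)

lemma ring_polynomial_algebra: "ring (polynomial_algebra :: ('k :: field, _) module)"
proof (rule ringI)
  show "abelian_group (polynomial_algebra :: ('k, _) module)"
    by (rule abelian_groupI)
       (auto simp: polynomial_algebra_def algebra_simps intro: exI[of _ "- x" for x])
  show "Group.monoid (polynomial_algebra :: ('k, _) module)"
    by (rule monoidI) (auto simp: polynomial_algebra_def algebra_simps)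
qed (simp_all add: polynomial_algebra_def algebra_simps)

text \<open>For a linear bijection onto an algebra with full carrier, multiplicativity only has to
  be checked on basis elements.\<close>

lemma (in based_algebra) ring_isoI:
  fixes T :: "('b \<Rightarrow>\<^sub>0 'k) \<Rightarrow> 'c :: ab_group_add" and C :: "('k, 'c) module"
  assumes C: "carrier C = UNIV" "add C = (+)"
    and C_add: "\<And>x y z. (x + y) \<otimes>\<^bsub>C\<^esub> z = x \<otimes>\<^bsub>C\<^esub> z + y \<otimes>\<^bsub>C\<^esub> z" "\<And>x y z. x \<otimes>\<^bsub>C\<^esub> (y + z) = x \<otimes>\<^bsub>C\<^esub> y + x \<otimes>\<^bsub>C\<^esub> z"
    and C_smult: "\<And>c x y. (c \<odot>\<^bsub>C\<^esub> x) \<otimes>\<^bsub>C\<^esub> y = c \<odot>\<^bsub>C\<^esub> (x \<otimes>\<^bsub>C\<^esub> y)" "\<And>c x y. x \<otimes>\<^bsub>C\<^esub> (c \<odot>\<^bsub>C\<^esub> y) = c \<odot>\<^bsub>C\<^esub> (x \<otimes>\<^bsub>C\<^esub> y)"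
    and T_add: "\<And>f g. T (f + g) = T f + T g"
    and T_scale: "\<And>c f. T (scale c f) = c \<odot>\<^bsub>C\<^esub> T f"
    and T_one: "T e = \<one>\<^bsub>C\<^esub>"
    and T_mult: "\<And>p q. \<lbrakk>p \<in> B; q \<in> B\<rbrakk> \<Longrightarrow> T (\<mu> p q) = T (basis_elt p) \<otimes>\<^bsub>C\<^esub> T (basis_elt q)"
    and bij: "bij_betw T {f. Poly_Mapping.keys f \<subseteq> B} UNIV"
  shows "T \<in> ring_iso A C"
proof -
  have T0: "T 0 = 0" using T_add[of 0 0] by simp
  have mult0: "0 \<otimes>\<^bsub>C\<^esub> x = 0" "x \<otimes>\<^bsub>C\<^esub> 0 = 0" for x
    using C_add(1)[of 0 0 x] C_add(2)[of x 0 0] by simp_all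
  have 1: "T (bilinear_ext \<mu> (basis_elt p) g) = T (basis_elt p) \<otimes>\<^bsub>C\<^esub> T g"
    if "Poly_Mapping.keys g \<subseteq> B" "p \<in> B" for p g
    using that by (induction g rule: basis_induct)
      (simp_all add: bilinear_ext_simps T_add T_scale T_mult T0 mult0 C_add C_smult)
  have 2: "T (bilinear_ext \<mu> f g) = T f \<otimes>\<^bsub>C\<^esub> T g"
    if "Poly_Mapping.keys f \<subseteq> B" "Poly_Mapping.keys g \<subseteq> B" for f g
    using that by (induction f rule: basis_induct)
      (simp_all add: bilinear_ext_simps T_add T_scale 1 T0 mult0 C_add C_smult)
  show ?thesis
    by (rule ring_iso_memI) (use bij in \<open>simp_all add: C 2 T_add T_one\<close>)
qed

lemma (in based_algebra) quotient_genideal_isomorphic: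
  assumes "T \<in> ring_iso A C" "ring C" "S \<subseteq> carrier A"
    and "\<And>c f. T (scale c f) = c \<odot>\<^bsub>C\<^esub> T f"
  shows "algebra_isomorphic (quotient_algebra A (Idl S)) (quotient_algebra C (Idl\<^bsub>C\<^esub> (T ` S)))"
  unfolding genideal_iso_image[OF assms(1) ring_axioms assms(2,3), symmetric]
  by (rule quotient_algebra_isomorphic[OF assms(1) ring_axioms assms(2) genideal_ideal[OF assms(3)]])
     (simp_all add: assms(4) scale_closed)

section \<open>Path algebras of roses: ground field, polynomials, free algebra\<close>

context
  fixes Q :: "('v, 'a) pre_digraph" and z L
  assumes rose: "is_rose Q z L"
begin

lemma wf_digraph_rose: "wf_digraph Q"
  using rose by unfold_locales (auto simp: is_rose_def)

lemma awalk_rose: "pre_digraph.awalk Q u p v \<longleftrightarrow> u = z \<and> v = z \<and> set p \<subseteq> L"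
proof -
  interpret wf_digraph Q by (rule wf_digraph_rose)
  show ?thesis
    by (induction p arbitrary: u) (use rose in \<open>auto simp: awalk_simps is_rose_def\<close>)
qed

lemma paths_rose: "paths Q = {z} \<times> lists L"
  by (auto simp: paths_def awalk_rose)

lemma path_prod_rose: "p \<in> lists L \<Longrightarrow> path_prod Q (z, p) (z, q) = basis_elt (z, p @ q)"
  by (auto simp: path_prod_def awalk_rose)

lemma based_algebra_rose:
  "based_algebra (path_algebra Q :: ('k :: field, _) module) (paths Q) (path_prod Q) (basis_elt (z, []))"
  using wf_digraph.based_algebra_path_algebra[OF wf_digraph_rose, where 'k = 'k] rose
  by (simp add: is_rose_def)

end

text \<open>The trivial path is the only path, so the path algebra is one-dimensional; the
  isomorphism reads off its coefficient, and the ideal generated by no element is zero.\<close>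

lemma quotient_path_algebra_rose_empty:
  assumes "is_rose Q z {}"
  shows "algebra_isomorphic (quotient_algebra (path_algebra Q) (Idl\<^bsub>path_algebra Q\<^esub> {}))
    (base_algebra :: ('k :: field, 'k) module)"
proof -
  interpret based_algebra "path_algebra Q :: ('k, _) module" "paths Q" "path_prod Q" "basis_elt (z, [])"
    by (rule based_algebra_rose[OF assms])
  have B: "paths Q = {(z, [])}" by (simp add: paths_rose[OF assms])
  let ?T = "\<lambda>f. Poly_Mapping.lookup f (z, []) :: 'k"
  have "?T \<in> ring_iso (path_algebra Q) base_algebra"
  proof (rule ring_isoI)
    show "bij_betw ?T {f. Poly_Mapping.keys f \<subseteq> paths Q} UNIV"
    proof (rule bij_betwI[of _ _ _ "\<lambda>c. scale c (basis_elt (z, []))"])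
      show "(\<lambda>c. scale c (basis_elt (z, []))) \<in> UNIV \<rightarrow> {f. Poly_Mapping.keys f \<subseteq> paths Q}"
        by (auto simp: B split: if_splits dest: subsetD[OF keys_scale])
      fix f :: "_ \<Rightarrow>\<^sub>0 'k" assume "f \<in> {f. Poly_Mapping.keys f \<subseteq> paths Q}"
      then show "scale (?T f) (basis_elt (z, [])) = f"
        using sum_basis_elt[of "{(z, [])}" f] by (simp add: B)
    qed auto
  qed (auto simp: base_algebra_def lookup_add algebra_simps B path_prod_rose[OF assms])
  then have "algebra_isomorphic (quotient_algebra (path_algebra Q) {\<zero>\<^bsub>path_algebra Q\<^esub>})
    (base_algebra :: ('k, 'k) module)"
    by (rule quotient_algebra_zero_isomorphic[OF _ ring_axioms]) (simp_all add: scale_closed, simp add: base_algebra_def)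
  moreover have "Idl\<^bsub>path_algebra Q\<^esub> {} = {\<zero>\<^bsub>path_algebra Q :: ('k, _) module\<^esub>}"
    using genideal_minimal[OF zeroideal, of "{}"] ideal_zero[OF genideal_ideal[of "{}"]] by auto
  ultimately show ?thesis by simp
qed

definition rose_poly :: "'v \<Rightarrow> 'a \<Rightarrow> (('v, 'a) path \<Rightarrow>\<^sub>0 'k :: field) \<Rightarrow> 'k poly" where
  "rose_poly z a f = Abs_poly (\<lambda>n. Poly_Mapping.lookup f (z, replicate n a))"

text \<open>\<open>Abs_poly\<close> is meaningful only for almost everywhere vanishing sequences.
  This holds since n determines the path \<open>replicate n a\<close>, so the finite support of f
  pulls back to a finite set.\<close>

lemma coeff_rose_poly: "coeff (rose_poly z a f) n = Poly_Mapping.lookup f (z, replicate n a)"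
proof -
  let ?g = "\<lambda>n. (z, replicate n a)"
  have "inj ?g" by (auto simp: inj_def dest: arg_cong[where f = length])
  then have "finite (?g -` Poly_Mapping.keys f)" by (intro finite_vimageI) simp_all
  then have "MOST n. Poly_Mapping.lookup f (z, replicate n a) = 0"
    by (simp add: MOST_iff_cofinite in_keys_iff vimage_def)
  then show ?thesis by (simp add: rose_poly_def Abs_poly_inverse)
qed

lemma rose_poly_add: "rose_poly z a (f + g) = rose_poly z a f + rose_poly z a g"
  by (rule poly_eqI) (simp add: coeff_rose_poly lookup_add)

lemma rose_poly_scale: "rose_poly z a (scale c f) = smult c (rose_poly z a f)"
  by (rule poly_eqI) (simp add: coeff_rose_poly)

lemma rose_poly_basis: "rose_poly z a (basis_elt (z, replicate n a)) = monom 1 n"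
  by (rule poly_eqI) (auto simp: coeff_rose_poly lookup_single when_def dest: arg_cong[where f = length])

lemma quotient_path_algebra_rose_one:
  fixes S :: "(('v, 'a) path \<Rightarrow>\<^sub>0 'k :: field) set"
  assumes rose: "is_rose Q z {a}" and S: "S \<subseteq> carrier (path_algebra Q)"
  shows "algebra_isomorphic (quotient_algebra (path_algebra Q) (Idl\<^bsub>path_algebra Q\<^esub> S))
    (quotient_algebra polynomial_algebra (Idl\<^bsub>polynomial_algebra\<^esub> (rose_poly z a ` S)))"
proof -
  interpret based_algebra "path_algebra Q :: ('k, _) module" "paths Q" "path_prod Q" "basis_elt (z, [])"
    by (rule based_algebra_rose[OF rose])
  let ?T = "rose_poly z a :: (('v, 'a) path \<Rightarrow>\<^sub>0 'k) \<Rightarrow> 'k poly"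
  have B: "p \<in> paths Q \<longleftrightarrow> (\<exists>n. p = (z, replicate n a))" for p
    by (cases p) (auto simp: paths_rose[OF rose] intro!: exI[of _ "length _"] replicate_length_same[symmetric])
  have "?T \<in> ring_iso (path_algebra Q) polynomial_algebra"
  proof (rule ring_isoI)
    have inj_on: "inj_on ?T {f. Poly_Mapping.keys f \<subseteq> paths Q}"
    proof (rule inj_onI)
      fix f g :: "('v, 'a) path \<Rightarrow>\<^sub>0 'k"
      assume fg: "f \<in> {f. Poly_Mapping.keys f \<subseteq> paths Q}" "g \<in> {f. Poly_Mapping.keys f \<subseteq> paths Q}"
        and eq: "?T f = ?T g"
      show "f = g"
      proof (rule poly_mapping_eqI)
        fix p
        show "Poly_Mapping.lookup f p = Poly_Mapping.lookup g p"
        proof (cases "p \<in> paths Q")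
          case True
          then obtain n where "p = (z, replicate n a)" by (auto simp: B)
          then show ?thesis using arg_cong[OF eq, of "\<lambda>h. coeff h n"] by (simp add: coeff_rose_poly)
        next
          case False
          then have "p \<notin> Poly_Mapping.keys f" "p \<notin> Poly_Mapping.keys g" using fg by auto
          then show ?thesis by (simp add: in_keys_iff)
        qed
      qed
    qed
    have surj: "q \<in> ?T ` {f. Poly_Mapping.keys f \<subseteq> paths Q}" for q
    proof -
      \<comment> \<open>A preimage is built monomial by monomial; the exponents up to the degree of
        q then give q itself.\<close>
      have "\<exists>f. Poly_Mapping.keys f \<subseteq> paths Q \<and> ?T f = (\<Sum>i\<in>N. monom (coeff q i) i)" if "finite N" for N
        using that
      proof (induction N rule: finite_induct)
        case empty
        have "?T 0 = 0" by (rule poly_eqI) (simp add: coeff_rose_poly)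
        then show ?case by (intro exI[of _ 0]) simp
      next
        case (insert x N)
        then obtain f where f: "Poly_Mapping.keys f \<subseteq> paths Q" "?T f = (\<Sum>i\<in>N. monom (coeff q i) i)" by auto
        let ?g = "scale (coeff q x) (basis_elt (z, replicate x a))"
        have "Poly_Mapping.keys ?g \<subseteq> paths Q" by (rule scale_closed) (auto simp: B)
        then have "Poly_Mapping.keys (?g + f) \<subseteq> paths Q" using f(1) by (rule add_closed)
        moreover have "?T (?g + f) = (\<Sum>i\<in>insert x N. monom (coeff q i) i)"
          using f(2) insert.hyps
          by (simp add: rose_poly_add rose_poly_scale rose_poly_basis smult_monom)
        ultimately show ?case by blast
      qed
      from this[of "{..degree q}"] obtain f where "Poly_Mapping.keys f \<subseteq> paths Q" "?T f = q"
        by (auto simp: poly_as_sum_of_monoms)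
      then show ?thesis by auto
    qed
    show "bij_betw ?T {f. Poly_Mapping.keys f \<subseteq> paths Q} UNIV"
      using inj_on surj by (auto simp: bij_betw_def)
    show "?T (path_prod Q p q) = ?T (basis_elt p) \<otimes>\<^bsub>polynomial_algebra\<^esub> ?T (basis_elt q)"
      if "p \<in> paths Q" "q \<in> paths Q" for p q
    proof -
      from that obtain m n where "p = (z, replicate m a)" "q = (z, replicate n a)" by (auto simp: B)
      moreover have "replicate m a \<in> lists {a}" by auto
      ultimately show ?thesis
        by (simp add: path_prod_rose[OF rose] rose_poly_basis polynomial_algebra_def mult_monom
            flip: replicate_add)
    qed
    show "?T (basis_elt (z, [])) = \<one>\<^bsub>polynomial_algebra\<^esub>"
      using rose_poly_basis[of z a 0] by (simp add: polynomial_algebra_def)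
  qed (simp_all add: polynomial_algebra_def rose_poly_add rose_poly_scale algebra_simps smult_add_right)
  then show ?thesis
    by (rule quotient_genideal_isomorphic[OF _ ring_polynomial_algebra S])
       (simp add: polynomial_algebra_def rose_poly_scale)
qed

text \<open>The map goes from words to paths because \<open>Poly_Mapping.map_key\<close> pulls
  coefficients back along it; this requires injectivity, hence distinct loops.\<close>

definition rose_path :: "'v \<Rightarrow> 'a \<Rightarrow> 'a \<Rightarrow> letter list \<Rightarrow> ('v, 'a) path" where
  "rose_path z a b w = (z, map (case_letter a b) w)"

lemma inj_rose_path: "a \<noteq> b \<Longrightarrow> inj (rose_path z a b)"
proof -
  assume "a \<noteq> b"
  then have "inj (case_letter a b)" by (auto simp: inj_def split: letter.splits)
  then show ?thesis by (simp add: inj_def rose_path_def inj_map_eq_map)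
qed

lemma quotient_path_algebra_rose_two:
  fixes S :: "(('v, 'a) path \<Rightarrow>\<^sub>0 'k :: field) set"
  assumes rose: "is_rose Q z {a, b}" and ab: "a \<noteq> b" and S: "S \<subseteq> carrier (path_algebra Q)"
  shows "algebra_isomorphic (quotient_algebra (path_algebra Q) (Idl\<^bsub>path_algebra Q\<^esub> S))
    (quotient_algebra free_algebra (Idl\<^bsub>free_algebra\<^esub> (Poly_Mapping.map_key (rose_path z a b) ` S)))"
proof -
  interpret based_algebra "path_algebra Q :: ('k, _) module" "paths Q" "path_prod Q" "basis_elt (z, [])"
    by (rule based_algebra_rose[OF rose])
  interpret F: based_algebra "free_algebra :: ('k, letter list \<Rightarrow>\<^sub>0 'k) module" UNIV
      "\<lambda>u w. basis_elt (u @ w)" "basis_elt []"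
    by (rule based_algebra_free_algebra)
  let ?T = "Poly_Mapping.map_key (rose_path z a b) :: (('v, 'a) path \<Rightarrow>\<^sub>0 'k) \<Rightarrow> _"
  note inj = inj_rose_path[OF ab, of z]
  have B: "p \<in> paths Q \<longleftrightarrow> (\<exists>w. p = rose_path z a b w)" for p
  proof (cases p)
    case (Pair u w)
    have "x = a \<or> x = b \<longleftrightarrow> (\<exists>l. x = case_letter a b l)" for x
    proof
      assume "\<exists>l. x = case_letter a b l"
      then obtain l where "x = case_letter a b l" by blast
      then show "x = a \<or> x = b" by (cases l) auto
    qed (auto intro: exI[of _ X] exI[of _ Y])
    then have "(\<forall>x\<in>set w. x = a \<or> x = b) \<longleftrightarrow> (\<forall>x\<in>set w. \<exists>l. x = case_letter a b l)"
      by simp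
    then show ?thesis
      by (auto simp: Pair paths_rose[OF rose] rose_path_def ex_map_conv[symmetric] in_lists_conv_set)
  qed
  have lookup: "Poly_Mapping.lookup (?T f) w = Poly_Mapping.lookup f (rose_path z a b w)" for f w
    using inj by (simp add: Poly_Mapping.map_key.rep_eq)
  have T_scale: "?T (scale c f) = scale c (?T f)" for c f
    by (rule poly_mapping_eqI) (simp add: lookup)
  have T_add: "?T (f + g) = ?T f + ?T g" for f g
    by (rule poly_mapping_eqI) (simp add: lookup lookup_add)
  have T_basis: "?T (basis_elt (rose_path z a b w)) = basis_elt w" for w
    using inj by (rule map_key_single)
  have "?T \<in> ring_iso (path_algebra Q) free_algebra"
  proof (rule ring_isoI)
    have inj_on: "inj_on ?T {f. Poly_Mapping.keys f \<subseteq> paths Q}"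
    proof (rule inj_onI)
      fix f g :: "('v, 'a) path \<Rightarrow>\<^sub>0 'k"
      assume fg: "f \<in> {f. Poly_Mapping.keys f \<subseteq> paths Q}" "g \<in> {f. Poly_Mapping.keys f \<subseteq> paths Q}"
        and eq: "?T f = ?T g"
      show "f = g"
      proof (rule poly_mapping_eqI)
        fix p
        show "Poly_Mapping.lookup f p = Poly_Mapping.lookup g p"
        proof (cases "p \<in> paths Q")
          case True
          then obtain w where "p = rose_path z a b w" by (auto simp: B)
          then show ?thesis using arg_cong[OF eq, of "\<lambda>h. Poly_Mapping.lookup h w"] by (simp add: lookup)
        next
          case False
          then have "p \<notin> Poly_Mapping.keys f" "p \<notin> Poly_Mapping.keys g" using fg by auto
          then show ?thesis by (simp add: in_keys_iff)
        qed
      qed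
    qed
    have surj: "q \<in> ?T ` {f. Poly_Mapping.keys f \<subseteq> paths Q}" for q
    proof -
      have "\<exists>f. Poly_Mapping.keys f \<subseteq> paths Q \<and> ?T f = q"
        using subset_UNIV[of "Poly_Mapping.keys q"]
      proof (induction q rule: basis_induct)
        case zero
        then show ?case by (intro exI[of _ 0]) (simp add: inj)
      next
        case (scale c w)
        have "Poly_Mapping.keys (Poly_Mapping.map ((*) c) (basis_elt (rose_path z a b w))) \<subseteq> paths Q"
          by (rule scale_closed) (auto simp: B)
        then show ?case by (intro exI[of _ "Poly_Mapping.map ((*) c) (basis_elt (rose_path z a b w))"]) (simp add: T_scale T_basis)
      next
        case (add f g)
        then obtain f' g' where "Poly_Mapping.keys f' \<subseteq> paths Q" "?T f' = f"
          "Poly_Mapping.keys g' \<subseteq> paths Q" "?T g' = g" by auto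
        then show ?case by (intro exI[of _ "f' + g'"]) (simp add: T_add add_closed)
      qed
      then show ?thesis by auto
    qed
    show "bij_betw ?T {f. Poly_Mapping.keys f \<subseteq> paths Q} UNIV"
      using inj_on surj by (auto simp: bij_betw_def)
    show "?T (path_prod Q p q) = ?T (basis_elt p) \<otimes>\<^bsub>free_algebra\<^esub> ?T (basis_elt q)"
      if pq: "p \<in> paths Q" "q \<in> paths Q" for p q
    proof -
      from pq obtain v w where vw: "p = rose_path z a b v" "q = rose_path z a b w" by (auto simp: B)
      then have "path_prod Q p q = (basis_elt (rose_path z a b (v @ w)) :: _ \<Rightarrow>\<^sub>0 'k)"
        using pq paths_rose[OF rose] by (simp add: rose_path_def path_prod_rose[OF rose])
      then show ?thesis by (simp add: vw T_basis free_algebra_def)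
    qed
    show "?T (basis_elt (z, [])) = \<one>\<^bsub>free_algebra\<^esub>"
      using T_basis[of "[]"] by (simp add: rose_path_def free_algebra_def)
  qed (simp_all add: free_algebra_def T_add T_scale bilinear_ext_simps)
  then show ?thesis
    by (rule quotient_genideal_isomorphic[OF _ F.ring_axioms S])
       (simp add: free_algebra_def T_scale)
qed

section \<open>Brauer graph algebras\<close>

lemma (in based_algebra) coset_eq_iff:
  assumes I: "ideal I A"
  shows "I +> x = I +> y \<longleftrightarrow> x - y \<in> I"
proof
  assume eq: "I +> x = I +> y"
  have "x \<in> I +> x" using ideal_zero[OF I] by (force simp: a_r_coset_def')
  then have "x \<in> I +> y" by (simp only: eq)
  then show "x - y \<in> I" by (auto simp: a_r_coset_def')
next
  assume xy: "x - y \<in> I"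
  have "i + x \<in> I +> y" if "i \<in> I" for i
    using ideal_add[OF I that xy] by (auto simp: a_r_coset_def' intro!: bexI[of _ "i + (x - y)"])
  moreover have "i + y \<in> I +> x" if "i \<in> I" for i
    using ideal_diff[OF I that xy] by (auto simp: a_r_coset_def' intro!: bexI[of _ "i - (x - y)"])
  ultimately show "I +> x = I +> y" by (auto simp: a_r_coset_def'[of _ I])
qed

lemma map_list_power: "map f (list_power n w) = list_power n (map f w)"
  by (simp add: list_power_def map_concat)

lemma list_power_singleton: "list_power n [a] = replicate n a"
  by (induction n) (simp_all add: list_power_def)

lemma sublist_singleton_iff: "sublist [a] xs \<longleftrightarrow> a \<in> set xs"
  by (auto simp: sublist_def in_set_conv_decomp)

locale brauer_algebra =
  fixes \<G> :: "('v, 'e) brauer_graph" and I :: "(('e, 'e half_edge) path \<Rightarrow>\<^sub>0 'k :: field) set"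
  assumes brauer: "is_brauer_graph \<G>" and I_def: "I = brauer_ideal \<G>"
begin

section \<open>The successor permutation and the paths that follow it\<close>

abbreviation "Q \<equiv> brauer_quiver \<G>"
abbreviation "\<sigma> \<equiv> succ_half \<G>"
abbreviation "ep \<equiv> endpoint \<G>"

text \<open>The length of the special power starting at h. It depends only on the endpoint of h, and
  an endpoint is truncated exactly when it equals 1.\<close>

definition turns :: "'e half_edge \<Rightarrow> nat" where
  "turns h = multiplicity_at \<G> (ep h) * val \<G> (ep h)"

text \<open>A common form for special cycles (length \<open>val\<close>), special powers (length
  \<open>turns\<close>), relation (II) (length \<open>turns\<close> + 1) and all their
  prefixes.\<close>

definition orbit_path :: "'e half_edge \<Rightarrow> nat \<Rightarrow> 'e half_edge list" where
  "orbit_path h n = map (\<lambda>k. (\<sigma> ^^ k) h) [0..<n]"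

lemma fin_digraph: "fin_digraph (graph \<G>)"
  using brauer by (simp add: is_brauer_graph_def)

lemma arcs_Q: "h \<in> arcs Q \<longleftrightarrow> fst h \<in> arcs (graph \<G>) \<and> ep h \<in> nontruncated_verts \<G>"
  by (cases h) (auto simp: brauer_quiver_def half_edges_def)

lemma quiver_simps [simp]: "verts Q = arcs (graph \<G>)" "tail Q = fst" "head Q h = fst (\<sigma> h)"
  by (simp_all add: brauer_quiver_def)

lemma ep_in_verts: "fst h \<in> arcs (graph \<G>) \<Longrightarrow> ep h \<in> verts (graph \<G>)"
proof -
  interpret fin_digraph "graph \<G>" by (rule fin_digraph)
  show "fst h \<in> arcs (graph \<G>) \<Longrightarrow> ep h \<in> verts (graph \<G>)" by (simp add: endpoint_def)
qed

lemma finite_arcs_Q: "finite (arcs Q)"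
proof -
  interpret fin_digraph "graph \<G>" by (rule fin_digraph)
  have "arcs Q \<subseteq> arcs (graph \<G>) \<times> UNIV" by (auto simp: arcs_Q)
  then show ?thesis by (rule finite_subset) simp
qed

lemma cyclic: "h \<in> arcs Q \<Longrightarrow> cyclic_on (succ_at \<G> (ep h)) (half_edges_at \<G> (ep h))"
  using brauer by (simp add: is_brauer_graph_def arcs_Q)

lemma in_half_edges_at: "h \<in> arcs Q \<Longrightarrow> h' \<in> half_edges_at \<G> (ep h) \<longleftrightarrow> h' \<in> arcs Q \<and> ep h' = ep h"
  by (cases h') (auto simp: half_edges_at_def arcs_Q half_edges_def)

lemma succ_arcs:
  assumes "h \<in> arcs Q"
  shows "\<sigma> h \<in> arcs Q" "ep (\<sigma> h) = ep h"
  using cyclic_on_inI[OF cyclic[OF assms], of h] assms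
  by (simp_all add: in_half_edges_at succ_half_def)

lemma funpow_succ:
  assumes "h \<in> arcs Q"
  shows "(\<sigma> ^^ n) h = (succ_at \<G> (ep h) ^^ n) h" "(\<sigma> ^^ n) h \<in> arcs Q" "ep ((\<sigma> ^^ n) h) = ep h"
proof -
  have "(\<sigma> ^^ n) h = (succ_at \<G> (ep h) ^^ n) h \<and> (\<sigma> ^^ n) h \<in> arcs Q \<and> ep ((\<sigma> ^^ n) h) = ep h"
    using assms by (induction n) (auto simp: succ_arcs, simp add: succ_half_def)
  then show "(\<sigma> ^^ n) h = (succ_at \<G> (ep h) ^^ n) h" "(\<sigma> ^^ n) h \<in> arcs Q" "ep ((\<sigma> ^^ n) h) = ep h"
    by auto
qed

lemma turns_funpow: "h \<in> arcs Q \<Longrightarrow> turns ((\<sigma> ^^ n) h) = turns h"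
  by (simp add: turns_def funpow_succ(3))

lemma turns_succ: "h \<in> arcs Q \<Longrightarrow> turns (\<sigma> h) = turns h"
  by (simp add: turns_def succ_arcs)

text \<open>By cyclicity the half-edges at the endpoint of h form one orbit, and the size of a
  finite orbit is its first return time. So \<open>val\<close> is that return time, from which all
  three facts follow.\<close>

lemma
  assumes h: "h \<in> arcs Q"
  shows funpow_val: "(\<sigma> ^^ val \<G> (ep h)) h = h"
    and ex_funpow: "\<lbrakk>h' \<in> arcs Q; ep h' = ep h\<rbrakk> \<Longrightarrow> \<exists>k < val \<G> (ep h). h' = (\<sigma> ^^ k) h"
    and val_pos: "val \<G> (ep h) > 0"
proof -
  let ?f = "succ_at \<G> (ep h)" and ?H = "half_edges_at \<G> (ep h)"
  let ?d = "funpow_dist1 ?f h h"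
  have "h \<in> ?H" using h by (simp add: in_half_edges_at)
  then have H: "?H = orbit ?f h" using cyclic[OF h] by (simp add: cyclic_on_alldef)
  then have o: "h \<in> orbit ?f h" using \<open>h \<in> ?H\<close> by simp
  have "val \<G> (ep h) = ?d"
    unfolding val_def H
    by (subst orbit_conv_funpow_dist1[OF o], subst card_image[OF inj_on_funpow_dist1[OF o]]) simp
  then show "(\<sigma> ^^ val \<G> (ep h)) h = h" "val \<G> (ep h) > 0"
    using funpow_dist1_prop[OF o] by (simp_all add: funpow_succ[OF h] del: funpow.simps)
  assume "h' \<in> arcs Q" "ep h' = ep h"
  then have "h' \<in> orbit ?f h" using h H by (simp add: in_half_edges_at flip: H)
  then show "\<exists>k < val \<G> (ep h). h' = (\<sigma> ^^ k) h"
    unfolding orbit_conv_funpow_dist1[OF o] \<open>val \<G> (ep h) = ?d\<close> funpow_succ(1)[OF h] by auto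
qed

lemma multiplicity_pos: "h \<in> arcs Q \<Longrightarrow> multiplicity_at \<G> (ep h) > 0"
  using brauer ep_in_verts by (auto simp: is_brauer_graph_def arcs_Q)

lemma val_le_turns: "h \<in> arcs Q \<Longrightarrow> val \<G> (ep h) \<le> turns h"
  using multiplicity_pos by (auto simp: turns_def Suc_le_eq)

lemma turns_pos: "h \<in> arcs Q \<Longrightarrow> turns h > 0"
  using multiplicity_pos val_pos by (simp add: turns_def)

lemma succ_eq_self: "\<lbrakk>h \<in> arcs Q; val \<G> (ep h) = 1\<rbrakk> \<Longrightarrow> \<sigma> h = h"
  using funpow_val[of h] by simp

lemma length_orbit_path [simp]: "length (orbit_path h n) = n"
  by (simp add: orbit_path_def)

lemma nth_orbit_path: "k < n \<Longrightarrow> orbit_path h n ! k = (\<sigma> ^^ k) h"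
  by (simp add: orbit_path_def)

lemma orbit_path_add: "orbit_path h (m + n) = orbit_path h m @ orbit_path ((\<sigma> ^^ m) h) n"
  by (rule nth_equalityI)
     (auto simp: nth_append nth_orbit_path funpow_add[symmetric, THEN fun_cong, simplified] simp del: funpow.simps)

lemma orbit_path_0 [simp]: "orbit_path h 0 = []"
  by (simp add: orbit_path_def)

lemma orbit_path_1 [simp]: "orbit_path h (Suc 0) = [h]"
  by (simp add: orbit_path_def)

lemma orbit_path_Suc: "orbit_path h (Suc n) = h # orbit_path (\<sigma> h) n"
  using orbit_path_add[of h 1 n] by simp

lemma orbit_path_Suc': "orbit_path h (Suc n) = orbit_path h n @ [(\<sigma> ^^ n) h]"
  using orbit_path_add[of h n 1] by simp

lemma funpow_mult_val: "h \<in> arcs Q \<Longrightarrow> (\<sigma> ^^ (m * val \<G> (ep h))) h = h"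
  by (induction m) (simp_all add: funpow_add funpow_val)

lemma funpow_turns: "h \<in> arcs Q \<Longrightarrow> (\<sigma> ^^ turns h) h = h"
  by (simp add: turns_def funpow_mult_val)

section \<open>The relations and the ideal in terms of orbit paths\<close>

lemma special_power_eq: "h \<in> arcs Q \<Longrightarrow> special_power \<G> h = orbit_path h (turns h)"
proof -
  assume h: "h \<in> arcs Q"
  have "list_power m (orbit_path h (val \<G> (ep h))) = orbit_path h (m * val \<G> (ep h))" for m
    by (induction m) (simp_all add: list_power_def orbit_path_add funpow_val[OF h])
  then show ?thesis by (simp add: special_power_def special_cycle_def turns_def orbit_path_def)
qed

lemma hd_special_cycle: "h \<in> arcs Q \<Longrightarrow> hd (special_cycle \<G> h) = h"
  using val_pos[of h] by (simp add: special_cycle_def hd_map)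

lemma relations_II_eq:
  "relations_II \<G> = {basis_elt (fst h, orbit_path h (Suc (turns h))) | h. h \<in> arcs Q}"
  unfolding relations_II_def
  by (intro Collect_cong ex_cong1)
     (auto simp: arcs_Q half_edges_def mem_Times_iff orbit_path_Suc' special_power_eq hd_special_cycle funpow_turns)

sublocale W: wf_digraph Q
proof
  fix h assume "h \<in> arcs Q"
  then show "tail Q h \<in> verts Q" "head Q h \<in> verts Q"
    using succ_arcs(1)[of h] by (simp_all add: arcs_Q)
qed

lemma consecutive_orbit_path: "p @ [a, b] @ q = orbit_path h n \<Longrightarrow> b = \<sigma> a"
proof -
  assume eq: "p @ [a, b] @ q = orbit_path h n"
  have n: "Suc (length p) < n" using arg_cong[OF eq, of length] by simp
  have "orbit_path h n ! length p = a" "orbit_path h n ! Suc (length p) = b"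
    unfolding eq[symmetric] by (simp_all add: nth_append)
  with n show "b = \<sigma> a" by (simp add: nth_orbit_path)
qed

text \<open>At valency 1 the special cycle is too short to contain a a although
  \<open>\<sigma>\<close> fixes a; the exception in (III) compensates for this. At larger valency
  the special cycle at a begins with a followed by \<open>\<sigma> a\<close>. So in all cases (III)
  forbids exactly the products that leave the succession.\<close>

lemma relations_III_eq:
  "relations_III \<G> = {basis_elt (fst a, [a, b]) | a b.
    a \<in> arcs Q \<and> b \<in> arcs Q \<and> fst b = fst (\<sigma> a) \<and> b \<noteq> \<sigma> a}"
proof -
  have "(fst a, [a, b]) \<in> paths Q \<longleftrightarrow> a \<in> arcs Q \<and> b \<in> arcs Q \<and> fst b = fst (\<sigma> a)" for a b
  proof
    assume *: "a \<in> arcs Q \<and> b \<in> arcs Q \<and> fst b = fst (\<sigma> a)"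
    then have "fst (\<sigma> b) \<in> arcs (graph \<G>)" using succ_arcs(1) arcs_Q by blast
    then have "W.awalk (fst a) [a, b] (fst (\<sigma> b))"
      using * by (simp add: W.awalk_simps)
    then show "(fst a, [a, b]) \<in> paths Q" by (auto simp: paths_def)
  qed (auto simp: paths_def W.awalk_Cons_iff)
  moreover have "(\<not> (\<exists>h\<in>half_edges \<G>. endpoint \<G> h \<in> nontruncated_verts \<G> \<and>
            sublist [a, b] (special_cycle \<G> h)) \<and>
      \<not> (a = b \<and> val \<G> (endpoint \<G> a) = 1)) \<longleftrightarrow> b \<noteq> \<sigma> a" if a: "a \<in> arcs Q" for a b
  proof
    assume *: "b \<noteq> \<sigma> a"
    have "\<not> sublist [a, b] (special_cycle \<G> h)" for h
      using * consecutive_orbit_path[of _ a b _ h "val \<G> (ep h)"]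
      by (auto simp: sublist_def special_cycle_def orbit_path_def) metis
    moreover have "\<not> (a = b \<and> val \<G> (endpoint \<G> a) = 1)" using * succ_eq_self[OF a] by auto
    ultimately show "\<not> (\<exists>h\<in>half_edges \<G>. endpoint \<G> h \<in> nontruncated_verts \<G> \<and>
            sublist [a, b] (special_cycle \<G> h)) \<and>
      \<not> (a = b \<and> val \<G> (endpoint \<G> a) = 1)" by blast
  next
    assume *: "\<not> (\<exists>h\<in>half_edges \<G>. endpoint \<G> h \<in> nontruncated_verts \<G> \<and>
            sublist [a, b] (special_cycle \<G> h)) \<and>
      \<not> (a = b \<and> val \<G> (endpoint \<G> a) = 1)"
    show "b \<noteq> \<sigma> a"
    proof
      assume b: "b = \<sigma> a"
      \<comment> \<open>Valency 1 would give b = a, the excepted case; hence there is room for two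
        arrows in the special cycle.\<close>
      then have "val \<G> (ep a) \<noteq> 1" using * succ_eq_self[OF a] by auto
      then have "val \<G> (ep a) = Suc (Suc (val \<G> (ep a) - 2))"
        using val_pos[OF a] by linarith
      then obtain n where n: "val \<G> (ep a) = Suc (Suc n)" by blast
      have "special_cycle \<G> a = orbit_path a (Suc (Suc n))"
        by (simp only: special_cycle_def n orbit_path_def)
      also have "\<dots> = [] @ [a, b] @ orbit_path (\<sigma> b) n"
        by (simp add: b orbit_path_Suc)
      finally have "special_cycle \<G> a = [] @ [a, b] @ orbit_path (\<sigma> b) n" .
      then have "sublist [a, b] (special_cycle \<G> a)" unfolding sublist_def by blast
      then show False using * a by (cases a) (auto simp: arcs_Q half_edges_def)
    qed
  qed
  ultimately show ?thesis unfolding relations_III_def by blast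
qed

sublocale A: based_algebra "path_algebra Q :: ('k, _) module" "paths Q" "path_prod Q"
    "\<Sum>v\<in>verts Q. basis_elt (v, [])"
proof (rule W.based_algebra_path_algebra)
  interpret fin_digraph "graph \<G>" by (rule fin_digraph)
  show "finite (verts Q)" by simp
qed

lemma awalk_orbit_path:
  "h \<in> arcs Q \<Longrightarrow> W.awalk (fst h) (orbit_path h n) (fst ((\<sigma> ^^ n) h))"
proof (induction n arbitrary: h)
  case 0
  then show ?case by (simp add: W.awalk_Nil_iff arcs_Q)
next
  case (Suc n)
  then show ?case
    using Suc.IH[OF succ_arcs(1)[OF Suc.prems]]
    by (simp add: orbit_path_Suc W.awalk_Cons_iff funpow_swap1)
qed

lemma awalk_special: "h \<in> arcs Q \<Longrightarrow> W.awalk (fst h) (orbit_path h (turns h)) (fst h)"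
  using awalk_orbit_path[of h "turns h"] by (simp add: funpow_turns)

lemma pathsI: "W.awalk u p v \<Longrightarrow> (u, p) \<in> paths Q"
  by (auto simp: paths_def)

text \<open>The key dichotomy: a nonempty walk that leaves the succession somewhere is killed by
  (III), and any other one is determined by its first arrow and its length.\<close>

lemma awalk_eq_orbit_path_or_turn:
  assumes "W.awalk u p v" "p \<noteq> []"
  obtains (orbit) "hd p \<in> arcs Q" "u = fst (hd p)" "p = orbit_path (hd p) (length p)"
  | (turn) q a b r where "p = q @ [a, b] @ r" "b \<noteq> \<sigma> a"
proof -
  have "p = orbit_path (hd p) (length p) \<or> (\<exists>q a b r. p = q @ [a, b] @ r \<and> b \<noteq> \<sigma> a)"
    using assms(2)
  proof (induction p)
    case (Cons a p)
    show ?case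
    proof (cases p)
      case Nil
      then show ?thesis by simp
    next
      case p: (Cons b p')
      show ?thesis
      proof (cases "b = \<sigma> a")
        case False
        then have "a # p = [] @ [a, b] @ p'" by (simp add: p)
        with False show ?thesis by blast
      next
        case True
        from Cons p consider "p = orbit_path b (length p)"
          | q c d r where "p = q @ [c, d] @ r" "d \<noteq> \<sigma> c" by auto
        then show ?thesis
        proof cases
          case 1
          then show ?thesis using True by (simp add: orbit_path_Suc)
        next
          case 2
          then have "a # p = (a # q) @ [c, d] @ r" by simp
          with 2 show ?thesis by blast
        qed
      qed
    qed
  qed simp
  moreover have "hd p \<in> arcs Q" "u = fst (hd p)"
    using assms by (cases p; simp add: W.awalk_Cons_iff)+
  ultimately show thesis using that by blast
qed

lemma basis_in_ideal:
  fixes J :: "(('e, 'e half_edge) path \<Rightarrow>\<^sub>0 'k) set"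
  assumes J: "ideal J (path_algebra Q)" and "basis_elt (v, q) \<in> J"
    and "W.awalk u p v" "W.awalk v q w" "W.awalk w r x"
  shows "basis_elt (u, p @ q @ r) \<in> J"
proof -
  have "path_prod Q (u, p) (v, q) = (basis_elt (u, p @ q) :: _ \<Rightarrow>\<^sub>0 'k)"
    using assms by (simp add: path_prod_def)
  moreover have "W.awalk u (p @ q) w"
    using assms by (simp add: W.awalk_append_iff' del: W.awalk_append_iff)
  then have "path_prod Q (u, p @ q) (w, r) = (basis_elt (u, p @ q @ r) :: _ \<Rightarrow>\<^sub>0 'k)"
    by (simp add: path_prod_def del: W.awalk_append_iff)
  moreover have "bilinear_ext (path_prod Q) (bilinear_ext (path_prod Q) (basis_elt (u, p)) (basis_elt (v, q)))
      (basis_elt (w, r)) \<in> J"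
    using assms pathsI[OF assms(3)] pathsI[OF assms(5)]
    by (intro A.ideal_mult_right[OF J] A.ideal_mult_left[OF J]) auto
  ultimately show ?thesis by simp
qed

text \<open>Stated for any ideal containing (III), since it is used for the Brauer ideal and again
  for the ideals generated by the shorter lists of relations.\<close>

lemma turn_in_ideal:
  fixes J :: "(('e, 'e half_edge) path \<Rightarrow>\<^sub>0 'k) set"
  assumes J: "ideal J (path_algebra Q)" and "relations_III \<G> \<subseteq> J"
    and w: "W.awalk u (p @ [a, b] @ q) v" and "b \<noteq> \<sigma> a"
  shows "basis_elt (u, p @ [a, b] @ q) \<in> J"
proof -
  from w have ab: "a \<in> arcs Q" "b \<in> arcs Q" "fst b = fst (\<sigma> a)"
    and "W.awalk u p (fst a)" "W.awalk (fst (\<sigma> b)) q v"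
    by (auto simp: W.awalk_Cons_iff)
  moreover have "basis_elt (fst a, [a, b]) \<in> J"
    using ab assms(2,4) unfolding relations_III_eq by blast
  moreover have "W.awalk (fst a) [a, b] (fst (\<sigma> b))"
    using ab succ_arcs(1) by (auto simp: W.awalk_simps arcs_Q)
  ultimately show ?thesis using basis_in_ideal[OF J] by blast
qed

lemma relations_closed:
  "relations_I \<G> \<union> relations_II \<G> \<union> relations_III \<G> \<subseteq> carrier (path_algebra Q :: ('k, _) module)"
proof -
  have "relations_I \<G> \<subseteq> carrier (path_algebra Q :: ('k, _) module)"
  proof
    fix x :: "_ \<Rightarrow>\<^sub>0 'k" assume "x \<in> relations_I \<G>"
    then obtain i b where x: "x = basis_elt (i, special_power \<G> (i, b)) - basis_elt (i, special_power \<G> (i, \<not> b))"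
      and *: "(i, b) \<in> arcs Q" "(i, \<not> b) \<in> arcs Q"
      by (auto simp: relations_I_def arcs_Q)
    have "(i, special_power \<G> (i, b)) \<in> paths Q" "(i, special_power \<G> (i, \<not> b)) \<in> paths Q"
      using awalk_special[OF *(1)] awalk_special[OF *(2)] by (auto simp: special_power_eq * intro: pathsI)
    then show "x \<in> carrier (path_algebra Q)"
      unfolding x A.record_simps mem_Collect_eq by (intro order_trans[OF keys_diff]) auto
  qed
  moreover have "relations_II \<G> \<subseteq> carrier (path_algebra Q :: ('k, _) module)"
    using pathsI[OF awalk_orbit_path] by (auto simp: relations_II_eq)
  moreover have "relations_III \<G> \<subseteq> carrier (path_algebra Q :: ('k, _) module)"
    by (auto simp: relations_III_def)
  ultimately show ?thesis by blast
qed

section \<open>Special powers are nonzero and remember their edge\<close>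

lemma ideal_I: "ideal I (path_algebra Q)"
  unfolding I_def brauer_ideal_def by (rule A.genideal_ideal[OF relations_closed])

lemma relations_subset: "relations_I \<G> \<subseteq> I" "relations_II \<G> \<subseteq> I" "relations_III \<G> \<subseteq> I"
  using A.genideal_self[OF relations_closed] by (simp_all add: I_def brauer_ideal_def)

lemma relation_II_in_I: "h \<in> arcs Q \<Longrightarrow> basis_elt (fst h, orbit_path h (Suc (turns h))) \<in> I"
  using relations_subset(2) unfolding relations_II_eq by blast

text \<open>The arrow h occurs in the succession starting at g, so both have the same
  \<open>turns\<close>. The two paths then have equal length, which leaves no room for p and
  q.\<close>

lemma contains_special_power:
  assumes "p @ orbit_path h (turns h) @ q = orbit_path g (turns g)" "g \<in> arcs Q" "h \<in> arcs Q"
  shows "p = []" "q = []"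
proof -
  have len: "turns g = length p + turns h + length q"
    using arg_cong[OF assms(1), of length] by simp
  obtain n where n: "turns h = Suc n" using turns_pos[OF assms(3)] by (cases "turns h") auto
  have "orbit_path g (turns g) ! length p = h"
    unfolding assms(1)[symmetric] by (simp add: nth_append n orbit_path_Suc)
  then have "(\<sigma> ^^ length p) g = h" using len n by (simp add: nth_orbit_path)
  then have "turns h = turns g" using turns_funpow[OF assms(2)] by metis
  then show "p = []" "q = []" using len by simp_all
qed

text \<open>Relation (I) forces the sum over both half-edges of i: a single coefficient would be 1
  or -1 on it. In the algebra these paths are congruent and span the socle of the projective module
  at i, whence the name.\<close>

definition socle_coeff :: "'e \<Rightarrow> (('e, 'e half_edge) path \<Rightarrow>\<^sub>0 'k) \<Rightarrow> 'k" where
  "socle_coeff i f = (\<Sum>p\<in>{(i, orbit_path h (turns h)) | h. h \<in> arcs Q \<and> fst h = i}. Poly_Mapping.lookup f p)"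

lemma finite_special: "finite {(i, orbit_path h (turns h)) | h. h \<in> arcs Q \<and> fst h = i}"
  using finite_arcs_Q by (auto intro!: finite_subset[OF _ finite_imageI[of "arcs Q" "\<lambda>h. (i, orbit_path h (turns h))"]])

lemma socle_coeff_basis:
  "socle_coeff i (basis_elt (u, p)) = (if u = i \<and> (\<exists>h\<in>arcs Q. fst h = i \<and> p = orbit_path h (turns h)) then 1 else 0)"
proof -
  have "socle_coeff i (basis_elt (u, p)) =
    (\<Sum>q\<in>{(i, orbit_path h (turns h)) | h. h \<in> arcs Q \<and> fst h = i}. if q = (u, p) then 1 else 0)"
    unfolding socle_coeff_def by (rule sum.cong) (auto simp: lookup_single when_def)
  also have "\<dots> = (if (u, p) \<in> {(i, orbit_path h (turns h)) | h. h \<in> arcs Q \<and> fst h = i} then 1 else 0)"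
    using sum.delta[OF finite_special[of i], of "(u, p)" "\<lambda>_. 1 :: 'k"] by simp
  also have "(u, p) \<in> {(i, orbit_path h (turns h)) | h. h \<in> arcs Q \<and> fst h = i} \<longleftrightarrow>
      u = i \<and> (\<exists>h\<in>arcs Q. fst h = i \<and> p = orbit_path h (turns h))" by blast
  finally show ?thesis .
qed

lemma socle_coeff_add: "socle_coeff i (f + g) = socle_coeff i f + socle_coeff i g"
  by (simp add: socle_coeff_def lookup_add sum.distrib)

lemma socle_coeff_diff: "socle_coeff i (f - g) = socle_coeff i f - socle_coeff i g"
  by (simp add: socle_coeff_def lookup_minus sum_subtractf)

lemma socle_coeff_scale: "socle_coeff i (scale c f) = c * socle_coeff i f"
  by (simp add: socle_coeff_def sum_distrib_left)

lemma socle_coeff_zero: "socle_coeff i 0 = 0"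
  by (simp add: socle_coeff_def)

lemma bilinear_basis_3:
  "bilinear_ext (path_prod Q) (bilinear_ext (path_prod Q) (basis_elt (u, p)) (basis_elt (v, w))) (basis_elt (x, q))
    = (if W.awalk u p v \<and> W.awalk v w x then basis_elt (u, p @ w @ q) else (0 :: _ \<Rightarrow>\<^sub>0 'k))"
  by (auto simp: path_prod_def W.awalk_append_iff' simp del: W.awalk_append_iff)

text \<open>Multiplying (I) by paths leaves a difference of two special powers at the same edge, or
  of two paths that are not special powers, or 0. Multiples of (II) properly contain a special
  power, and multiples of (III) leave the succession, so none of them is a special power.\<close>

lemma socle_coeff_vanishes:
  assumes "x \<in> I"
  shows "socle_coeff i x = 0"
proof (rule A.functional_vanishes[OF relations_closed socle_coeff_add socle_coeff_scale])
  show "x \<in> Idl\<^bsub>path_algebra Q\<^esub> (relations_I \<G> \<union> relations_II \<G> \<union> relations_III \<G>)"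
    using assms by (simp add: I_def brauer_ideal_def)
  fix pp qq :: "('e, 'e half_edge) path" and s :: "_ \<Rightarrow>\<^sub>0 'k"
  obtain u p x q where pq: "pp = (u, p)" "qq = (x, q)" by (cases pp, cases qq)
  assume "s \<in> relations_I \<G> \<union> relations_II \<G> \<union> relations_III \<G>"
  then consider (I) j b where "s = basis_elt (j, special_power \<G> (j, b)) - basis_elt (j, special_power \<G> (j, \<not> b))"
      "(j, b) \<in> arcs Q" "(j, \<not> b) \<in> arcs Q"
    | (II) h where "s = basis_elt (fst h, orbit_path h (Suc (turns h)))" "h \<in> arcs Q"
    | (III) a b where "s = basis_elt (fst a, [a, b])" "b \<noteq> \<sigma> a"
    unfolding Un_iff relations_II_eq relations_III_eq by (auto simp: relations_I_def arcs_Q)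
  then show "socle_coeff i (bilinear_ext (path_prod Q) (bilinear_ext (path_prod Q) (basis_elt pp) s) (basis_elt qq)) = 0"
  proof cases
    case I
    have s: "s = basis_elt (j, orbit_path (j, b) (turns (j, b))) - basis_elt (j, orbit_path (j, \<not> b) (turns (j, \<not> b)))"
      by (simp add: I special_power_eq)
    have cl: "W.awalk j (orbit_path (j, b) (turns (j, b))) y \<longleftrightarrow> y = j"
      "W.awalk j (orbit_path (j, \<not> b) (turns (j, \<not> b))) y \<longleftrightarrow> y = j" for y
      using awalk_special[OF I(2)] awalk_special[OF I(3)] by (auto dest: W.awalk_ends)
    have ne: "socle_coeff i (basis_elt (u, p @ orbit_path h (turns h) @ q)) =
        (if p = [] \<and> q = [] \<and> u = i \<and> fst h = i then 1 else 0)" if "h \<in> arcs Q" "fst h = u \<or> p \<noteq> []" for h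
      using contains_special_power[of p h q] that by (auto simp: socle_coeff_basis)
    show ?thesis
    proof (cases "W.awalk u p j \<and> x = j")
      case True
      \<comment> \<open>An empty p starts and ends at u, which is the side condition of
        \<open>ne\<close>; the value there depends only on the edge j and not on the
        half-edge.\<close>
      then have "j = u \<or> p \<noteq> []" by (auto simp: W.awalk_Nil_iff)
      then have "socle_coeff i (basis_elt (u, p @ orbit_path (j, b) (turns (j, b)) @ q)) =
          socle_coeff i (basis_elt (u, p @ orbit_path (j, \<not> b) (turns (j, \<not> b)) @ q))"
        using ne[OF I(2)] ne[OF I(3)] by simp
      then show ?thesis
        using True
        by (simp add: s pq bilinear_ext_diff_left bilinear_ext_diff_right bilinear_basis_3 cl
            socle_coeff_diff del: bilinear_ext_basis)
    next
      case False
      then have "bilinear_ext (path_prod Q) (bilinear_ext (path_prod Q) (basis_elt pp) s) (basis_elt qq) = 0"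
        by (auto simp: s pq bilinear_ext_diff_left bilinear_ext_diff_right bilinear_basis_3 cl
            simp del: bilinear_ext_basis)
      then show ?thesis by (simp add: socle_coeff_zero)
    qed
  next
    case II
    have "p @ orbit_path h (Suc (turns h)) @ q \<noteq> orbit_path g (turns g)" if "g \<in> arcs Q" for g
      \<comment> \<open>The path in (II) is the special power followed by h once more, so the part
        after the special power is nonempty.\<close>
      using contains_special_power(2)[of p h "h # q" g] that II(2)
      by (auto simp: orbit_path_Suc' funpow_turns)
    then show ?thesis
      by (auto simp: II pq bilinear_basis_3 socle_coeff_basis socle_coeff_zero simp del: bilinear_ext_basis)
  next
    case III
    then have "p @ [a, b] @ q \<noteq> orbit_path g (turns g)" for g
      using consecutive_orbit_path by metis
    then show ?thesis
      unfolding III pq bilinear_basis_3 by (auto simp: socle_coeff_basis socle_coeff_zero)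
  qed
qed

lemma socle_coeff_special:
  "h \<in> arcs Q \<Longrightarrow> socle_coeff i (basis_elt (fst h, orbit_path h (turns h))) = (if fst h = i then 1 else 0)"
  unfolding socle_coeff_basis by (intro if_cong refl) blast

lemma special_notin: "h \<in> arcs Q \<Longrightarrow> basis_elt (fst h, orbit_path h (turns h)) \<notin> I"
  using socle_coeff_vanishes[of "basis_elt (fst h, orbit_path h (turns h))" "fst h"]
  by (auto simp: socle_coeff_special)

text \<open>For different edges the functional belonging to the edge of h takes the value 1 on the
  difference.\<close>

lemma special_congruent:
  assumes "h \<in> arcs Q" "g \<in> arcs Q"
    and "basis_elt (fst h, orbit_path h (turns h)) - basis_elt (fst g, orbit_path g (turns g)) \<in> I"
  shows "fst h = fst g"
  using socle_coeff_vanishes[OF assms(3), of "fst h"] assms(1,2)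
  by (auto simp: socle_coeff_diff socle_coeff_special split: if_splits)

text \<open>The last arrow of the special power is the predecessor of h, so any arrow other than h
  that is appended makes a product as in (III).\<close>

lemma special_power_snoc_in_ideal:
  fixes J :: "(('e, 'e half_edge) path \<Rightarrow>\<^sub>0 'k) set"
  assumes J: "ideal J (path_algebra Q)" "relations_III \<G> \<subseteq> J"
    and h: "h \<in> arcs Q" "a \<in> arcs Q" "fst a = fst h" "a \<noteq> h"
  shows "basis_elt (fst h, orbit_path h (turns h) @ [a]) \<in> J"
proof -
  obtain n where n: "turns h = Suc n" using turns_pos[OF h(1)] by (cases "turns h") auto
  have eq: "orbit_path h (turns h) @ [a] = orbit_path h n @ [(\<sigma> ^^ n) h, a] @ []"
    by (simp add: n orbit_path_Suc')
  have "fst (\<sigma> a) \<in> arcs (graph \<G>)" using succ_arcs(1)[OF h(2)] arcs_Q by blast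
  then have "W.awalk (fst h) (orbit_path h (turns h) @ [a]) (fst (\<sigma> a))"
    using awalk_special[OF h(1)] h
    by (simp add: W.awalk_append_iff' W.awalk_simps del: W.awalk_append_iff)
  moreover have "a \<noteq> \<sigma> ((\<sigma> ^^ n) h)" using funpow_turns[OF h(1)] h(4) by (simp add: n)
  ultimately show ?thesis unfolding eq by (rule turn_in_ideal[OF J])
qed

section \<open>Maximal paths are special powers\<close>

lemma special_power_maximal:
  assumes h: "h \<in> arcs Q" and a: "a \<in> arcs Q"
  shows "path_prod Q (fst a, [a]) (fst h, orbit_path h (turns h)) \<in> I"
    and "path_prod Q (fst h, orbit_path h (turns h)) (fst a, [a]) \<in> I"
proof -
  show "path_prod Q (fst a, [a]) (fst h, orbit_path h (turns h)) \<in> I"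
  proof (cases "W.awalk (fst a) [a] (fst h)")
    case True
    then have fst_h: "fst h = fst (\<sigma> a)" by (simp add: W.awalk_simps)
    have "basis_elt (fst a, a # orbit_path h (turns h)) \<in> I"
    proof (cases "h = \<sigma> a")
      case True
      \<comment> \<open>Prepending the predecessor of h gives the path of relation (II) at a,
        because \<open>turns\<close> agrees along the succession.\<close>
      then have "a # orbit_path h (turns h) = orbit_path a (Suc (turns a))"
        using turns_succ[OF a] by (simp add: orbit_path_Suc)
      then show ?thesis using relation_II_in_I[OF a] by simp
    next
      case False
      obtain n where n: "turns h = Suc n" using turns_pos[OF h] by (cases "turns h") auto
      have eq: "a # orbit_path h (turns h) = [] @ [a, h] @ orbit_path (\<sigma> h) n"
        by (simp add: n orbit_path_Suc)
      have "W.awalk (fst a) (a # orbit_path h (turns h)) (fst h)"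
        using a fst_h awalk_special[OF h] by (simp add: W.awalk_Cons_iff)
      then show ?thesis
        unfolding eq using False by (rule turn_in_ideal[OF ideal_I relations_subset(3)])
    qed
    then show ?thesis using True by (simp add: path_prod_def)
  qed (simp add: path_prod_def A.ideal_zero[OF ideal_I])
  show "path_prod Q (fst h, orbit_path h (turns h)) (fst a, [a]) \<in> I"
  proof (cases "W.awalk (fst h) (orbit_path h (turns h)) (fst a)")
    case True
    then have fst_a: "fst a = fst h" using awalk_special[OF h] by (auto dest: W.awalk_ends)
    have "basis_elt (fst h, orbit_path h (turns h) @ [a]) \<in> I"
    proof (cases "a = h")
      case True
      then have "orbit_path h (turns h) @ [a] = orbit_path h (Suc (turns h))"
        by (simp add: orbit_path_Suc' funpow_turns[OF h])
      then show ?thesis using relation_II_in_I[OF h] by simp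
    next
      case False
      then show ?thesis
        using special_power_snoc_in_ideal[OF ideal_I relations_subset(3) h a fst_a] by simp
    qed
    then show ?thesis using True by (simp add: path_prod_def)
  qed (simp add: path_prod_def A.ideal_zero[OF ideal_I])
qed

lemma special_power_in_maximal_paths:
  assumes "h \<in> arcs Q"
  shows "I +>\<^bsub>path_algebra Q\<^esub> basis_elt (fst h, orbit_path h (turns h)) \<in> maximal_paths Q I"
  unfolding maximal_paths_def arrow_elt_def
  using special_power_maximal[OF assms] special_notin[OF assms] pathsI[OF awalk_special[OF assms]]
  by (intro CollectI exI[of _ "(fst h, orbit_path h (turns h))"]) simp

lemma orbit_path_in_ideal_mono:
  assumes h: "h \<in> arcs Q" and I: "basis_elt (fst h, orbit_path h m) \<in> I" and "m \<le> n"
  shows "basis_elt (fst h, orbit_path h n) \<in> I"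
proof -
  obtain k where k: "n = m + k" using \<open>m \<le> n\<close> le_Suc_ex by blast
  have "orbit_path h n = [] @ orbit_path h m @ orbit_path ((\<sigma> ^^ m) h) k"
    by (simp add: k orbit_path_add)
  moreover have "W.awalk (fst h) [] (fst h)" using h by (simp add: W.awalk_Nil_iff arcs_Q)
  ultimately show ?thesis
    using basis_in_ideal[OF ideal_I I _ awalk_orbit_path[OF h] awalk_orbit_path[OF funpow_succ(2)[OF h]]]
    by metis
qed

text \<open>Such a path follows the succession by (III). If it were shorter than the special power,
  its vanishing extension by the next arrow would put the special power into the ideal; if longer,
  it would contain the path of relation (II).\<close>

lemma maximal_path_eq_special_power:
  assumes p: "(u, p) \<in> paths Q" "p \<noteq> []" and notin: "basis_elt (u, p) \<notin> I"
    and max: "\<And>a. a \<in> arcs Q \<Longrightarrow> path_prod Q (u, p) (fst a, [a]) \<in> I"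
  obtains h where "h \<in> arcs Q" "u = fst h" "p = orbit_path h (turns h)"
proof -
  obtain v where v: "W.awalk u p v" using p by (auto simp: paths_def)
  from v p(2) show thesis
  proof (cases rule: awalk_eq_orbit_path_or_turn)
    case (turn q a b r)
    then have "basis_elt (u, p) \<in> I"
      using turn_in_ideal[OF ideal_I relations_subset(3), of u q a b r v] v by simp
    with notin show thesis by contradiction
  next
    case orbit
    define h where "h = hd p"
    define n where "n = length p"
    have h: "h \<in> arcs Q" "u = fst h" "p = orbit_path h n" using orbit by (simp_all add: h_def n_def)
    consider "n < turns h" | "n = turns h" | "n > turns h" by linarith
    then show thesis
    proof cases
      case 1
      have "basis_elt (fst h, orbit_path h (Suc n)) \<in> I"
        using max[OF funpow_succ(2)[OF h(1), of n]] awalk_orbit_path[OF h(1), of n]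
        by (simp add: path_prod_def h(2,3) orbit_path_Suc')
      then have "basis_elt (fst h, orbit_path h (turns h)) \<in> I"
        by (rule orbit_path_in_ideal_mono[OF h(1)]) (use 1 in simp)
      with special_notin[OF h(1)] show thesis by contradiction
    next
      case 2
      with h that show thesis by blast
    next
      case 3
      have "basis_elt (fst h, orbit_path h (Suc (turns h))) \<in> I"
        by (rule relation_II_in_I[OF h(1)])
      then have "basis_elt (fst h, orbit_path h n) \<in> I"
        by (rule orbit_path_in_ideal_mono[OF h(1)]) (use 3 in simp)
      with notin show thesis by (simp add: h(2,3))
    qed
  qed
qed

section \<open>Unique maximal paths and the shape of the graph\<close>

lemma set_orbit_path_turns:
  assumes "h \<in> arcs Q" "g \<in> arcs Q" "ep g = ep h"
  shows "g \<in> set (orbit_path h (turns h))"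
proof -
  obtain k where "k < val \<G> (ep h)" "g = (\<sigma> ^^ k) h" using ex_funpow[OF assms] by blast
  then show ?thesis using val_le_turns[OF assms(1)] by (auto simp: orbit_path_def)
qed

text \<open>The special powers at g and at h both run through the arrow g and are both maximal.
  Uniqueness makes them congruent, and congruent special powers start at the same edge.\<close>

lemma UMP_imp_same_edge:
  assumes "UMP Q I" and h: "h \<in> arcs Q" and g: "g \<in> arcs Q" "ep g = ep h"
  shows "fst g = fst h"
proof -
  let ?M = "\<lambda>h. I +>\<^bsub>path_algebra Q\<^esub> basis_elt (fst h, orbit_path h (turns h))"
  have M: "?M h' \<in> maximal_paths Q I \<and>
      (\<exists>p\<in>paths Q. ?M h' = I +>\<^bsub>path_algebra Q\<^esub> basis_elt p \<and> sublist [g] (snd p))"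
    if h': "h' \<in> arcs Q" "ep g = ep h'" for h'
    using special_power_in_maximal_paths[OF h'(1)] set_orbit_path_turns[OF h'(1) g(1) h'(2)]
      pathsI[OF awalk_special[OF h'(1)]]
    by (intro conjI bexI[of _ "(fst h', orbit_path h' (turns h'))"]) (simp_all add: sublist_singleton_iff)
  have "?M g = ?M h" using M[OF g(1) refl] M[OF h g(2)] assms(1) g(1) unfolding UMP_def by blast
  then show ?thesis
    using special_congruent[OF g(1) h] A.coset_eq_iff[OF ideal_I] by simp
qed

lemma truncated_half_edges:
  assumes "v \<in> verts (graph \<G>)" "v \<notin> nontruncated_verts \<G>"
  shows "\<exists>h. half_edges_at \<G> v = {h}"
  using assms by (auto simp: nontruncated_verts_def truncated_def val_def card_1_singleton_iff)

lemma connected_walk: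
  assumes "u \<in> verts (graph \<G>)" "v \<in> verts (graph \<G>)"
  shows "(u, v) \<in> rtrancl_on (verts (graph \<G>)) ((arcs_ends (graph \<G>))\<^sup>s)"
  using brauer assms by (simp add: is_brauer_graph_def connected_conv)

lemma UMP_imp_single_arc:
  assumes "UMP Q I"
  shows "\<exists>i. arcs (graph \<G>) = {i}"
proof -
  interpret fin_digraph "graph \<G>" by (rule fin_digraph)
  let ?G = "graph \<G>"
  have same: "fst g = fst h" if "g \<in> half_edges_at \<G> v" "h \<in> half_edges_at \<G> v" for g h v
  proof (cases "v \<in> nontruncated_verts \<G>")
    case True
    with that UMP_imp_same_edge[OF assms, of h g] show ?thesis
      by (auto simp: half_edges_at_def half_edges_def arcs_Q)
  next
    \<comment> \<open>A truncated vertex has no arrows, so uniqueness of maximal paths is silent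
      here; but it has only one half-edge.\<close>
    case False
    have "v \<in> verts ?G" using that ep_in_verts[of h] by (auto simp: half_edges_at_def half_edges_def)
    from truncated_half_edges[OF this False] that show ?thesis by auto
  qed
  have half: "(e, False) \<in> half_edges_at \<G> (tail ?G e)" "(e, True) \<in> half_edges_at \<G> (head ?G e)"
    if "e \<in> arcs ?G" for e
    using that by (auto simp: half_edges_at_def half_edges_def endpoint_def)
  obtain i where i: "i \<in> arcs ?G" using brauer by (auto simp: is_brauer_graph_def)
  have all: "\<exists>b. (i, b) \<in> half_edges_at \<G> v"
    if "(tail ?G i, v) \<in> rtrancl_on (verts ?G) ((arcs_ends ?G)\<^sup>s)" for v
    using that
  proof (induction rule: rtrancl_on_induct)
    case base
    then show ?case using half(1)[OF i] by blast
  next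
    case (step v w)
    then obtain b where b: "(i, b) \<in> half_edges_at \<G> v" by blast
    from step.hyps obtain e where e: "e \<in> arcs ?G" "{v, w} = {tail ?G e, head ?G e}"
      by (auto simp: symcl_def arcs_ends_def arc_to_ends_def)
    then obtain c d where "(e, c) \<in> half_edges_at \<G> v" "(e, d) \<in> half_edges_at \<G> w"
      using half[OF e(1)] by (auto simp: doubleton_eq_iff)
    \<comment> \<open>Both i and e have a half-edge at v, so e = i, and the other half-edge of e is
      the one wanted at w.\<close>
    with same[OF b] show ?case by auto
  qed
  have "e = i" if e: "e \<in> arcs ?G" for e
    using all[OF connected_walk[of "tail ?G i" "tail ?G e"]] same[OF half(1)[OF e]] i e by auto
  with i show ?thesis by blast
qed

lemma single_arc_imp_UMP:
  assumes i: "arcs (graph \<G>) = {i}"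
  shows "UMP Q I"
  unfolding UMP_def
proof
  fix g assume g: "g \<in> arcs Q"
  let ?M = "\<lambda>h. I +>\<^bsub>path_algebra Q\<^esub> basis_elt (fst h, orbit_path h (turns h))"
  have congruent: "?M h = ?M g" if h: "h \<in> arcs Q" for h
  proof (cases "h = g")
    case False
    have "fst h = i" "fst g = i" using h g i by (simp_all add: arcs_Q)
    with False obtain b where b: "h = (i, b)" "g = (i, \<not> b)" by (cases h; cases g) auto
    \<comment> \<open>Two different arrows are the two half-edges of the only edge, so the
      difference of their special powers is a relation (I).\<close>
    have "basis_elt (fst h, orbit_path h (turns h)) - basis_elt (fst g, orbit_path g (turns g)) \<in> relations_I \<G>"
      using h g unfolding relations_I_def special_power_eq[OF h, symmetric] special_power_eq[OF g, symmetric]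
      by (auto simp: b arcs_Q)
    then show ?thesis using relations_subset(1) A.coset_eq_iff[OF ideal_I] by blast
  qed simp
  show "\<exists>!M. M \<in> maximal_paths Q I \<and>
      (\<exists>p\<in>paths Q. M = I +>\<^bsub>path_algebra Q\<^esub> basis_elt p \<and> sublist [g] (snd p))"
  proof (rule ex1I[of _ "?M g"], intro conjI)
    show "?M g \<in> maximal_paths Q I" by (rule special_power_in_maximal_paths[OF g])
    show "\<exists>p\<in>paths Q. ?M g = I +>\<^bsub>path_algebra Q\<^esub> basis_elt p \<and> sublist [g] (snd p)"
      using pathsI[OF awalk_special[OF g]] set_orbit_path_turns[OF g g refl]
      by (intro bexI[of _ "(fst g, orbit_path g (turns g))"]) (simp_all add: sublist_singleton_iff)
  next
    fix M assume M: "M \<in> maximal_paths Q I \<and>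
      (\<exists>p\<in>paths Q. M = I +>\<^bsub>path_algebra Q\<^esub> basis_elt p \<and> sublist [g] (snd p))"
    then obtain p where "p \<in> paths Q" "M = I +>\<^bsub>path_algebra Q\<^esub> basis_elt p" "sublist [g] (snd p)" by blast
    then have p: "p \<in> paths Q" "M = I +>\<^bsub>path_algebra Q\<^esub> basis_elt p" "snd p \<noteq> []"
      by (auto simp: sublist_singleton_iff)
    from M obtain p' where p': "p' \<in> paths Q" "M = I +>\<^bsub>path_algebra Q\<^esub> basis_elt p'" "basis_elt p' \<notin> I"
      "\<And>a. a \<in> arcs Q \<Longrightarrow> path_prod Q p' (fst a, [a]) \<in> I"
      by (auto simp: maximal_paths_def arrow_elt_def)
    \<comment> \<open>The representative p containing g may differ from the representative p' that
      witnesses maximality. Being nonzero and being annihilated by arrows both pass to congruent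
      elements, so they can be moved to the nonempty path p.\<close>
    have d: "basis_elt p - basis_elt p' \<in> I" "basis_elt p' - basis_elt p \<in> I"
      using p(2) p'(2) A.coset_eq_iff[OF ideal_I] by metis+
    have notin: "basis_elt p \<notin> I"
      using A.ideal_add[OF ideal_I d(2), of "basis_elt p"] p'(3) by auto
    have max: "path_prod Q p (fst a, [a]) \<in> I" if a: "a \<in> arcs Q" for a
    proof -
      have "(fst a, [a]) \<in> paths Q"
        using awalk_orbit_path[OF a, of 1] by (auto intro: pathsI)
      then have "path_prod Q p (fst a, [a]) - path_prod Q p' (fst a, [a]) \<in> I"
        using A.ideal_mult_right[OF ideal_I d(1), of "basis_elt (fst a, [a])"]
        by (simp add: bilinear_ext_diff_left)
      from A.ideal_add[OF ideal_I this p'(4)[OF a]] show ?thesis by simp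
    qed
    obtain h where "h \<in> arcs Q" "p = (fst h, orbit_path h (turns h))"
      using maximal_path_eq_special_power[of "fst p" "snd p"] p notin max by (metis prod.collapse)
    then show "M = ?M g" using p(2) congruent by simp
  qed
qed

text \<open>With one edge, connectedness leaves no vertices besides its ends; whether these coincide
  decides between loop and edge.\<close>

lemma single_arc_iff: "is_single_edge (graph \<G>) \<or> is_single_loop (graph \<G>) \<longleftrightarrow> (\<exists>i. arcs (graph \<G>) = {i})"
proof
  interpret fin_digraph "graph \<G>" by (rule fin_digraph)
  let ?G = "graph \<G>"
  assume "\<exists>i. arcs ?G = {i}"
  then obtain i where i: "arcs ?G = {i}" by blast
  have ends: "tail ?G i \<in> verts ?G" "head ?G i \<in> verts ?G" using i by auto
  have "v \<in> {tail ?G i, head ?G i}" if "(tail ?G i, v) \<in> rtrancl_on (verts ?G) ((arcs_ends ?G)\<^sup>s)" for v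
    using that
    by (induction rule: rtrancl_on_induct) (auto simp: symcl_def arcs_ends_def arc_to_ends_def i)
  then have "verts ?G = {tail ?G i, head ?G i}" using ends connected_walk by blast
  then show "is_single_edge ?G \<or> is_single_loop ?G"
    using i unfolding is_single_edge_def is_single_loop_def by (cases "tail ?G i = head ?G i") auto
qed (auto simp: is_single_edge_def is_single_loop_def)

lemma UMP_iff: "UMP Q I \<longleftrightarrow> is_single_edge (graph \<G>) \<or> is_single_loop (graph \<G>)"
  using UMP_imp_single_arc single_arc_imp_UMP single_arc_iff by blast

subsection \<open>Graphs with a single edge\<close>

lemma orbit_path_fixed: "\<sigma> h = h \<Longrightarrow> orbit_path h n = list_power n [h]"
  by (induction n) (simp_all add: orbit_path_Suc list_power_def)

lemma orbit_path_swapped: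
  "\<lbrakk>\<sigma> h = g; \<sigma> g = h\<rbrakk> \<Longrightarrow> orbit_path h (n * 2) = list_power n [h, g]"
  by (induction n) (simp_all add: orbit_path_Suc list_power_def)

lemma val_eq_card: "h \<in> arcs Q \<Longrightarrow> val \<G> (ep h) = card {g \<in> arcs Q. ep g = ep h}"
  unfolding val_def by (rule arg_cong[where f = card]) (auto simp: in_half_edges_at)

lemma turns_neq_1: "h \<in> arcs Q \<Longrightarrow> turns h \<noteq> 1"
  by (auto simp: arcs_Q nontruncated_verts_def truncated_def turns_def mult.commute)

lemma relations_I_eq:
  "(relations_I \<G> :: (_ \<Rightarrow>\<^sub>0 'k) set) = {basis_elt (fst h, orbit_path h (turns h)) - basis_elt (fst g, orbit_path g (turns g)) | h g.
    h \<in> arcs Q \<and> g \<in> arcs Q \<and> fst h = fst g \<and> h \<noteq> g}"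
proof (intro Set.set_eqI iffI)
  fix x :: "('e, 'e half_edge) path \<Rightarrow>\<^sub>0 'k"
  assume "x \<in> relations_I \<G>"
  then obtain i b where "x = basis_elt (i, special_power \<G> (i, b)) - basis_elt (i, special_power \<G> (i, \<not> b))"
    "(i, b) \<in> arcs Q" "(i, \<not> b) \<in> arcs Q"
    by (auto simp: relations_I_def arcs_Q)
  then show "x \<in> {basis_elt (fst h, orbit_path h (turns h)) - basis_elt (fst g, orbit_path g (turns g)) | h g.
    h \<in> arcs Q \<and> g \<in> arcs Q \<and> fst h = fst g \<and> h \<noteq> g}"
    by (intro CollectI exI[of _ "(i, b)"] exI[of _ "(i, \<not> b)"]) (simp add: special_power_eq)
next
  fix x :: "('e, 'e half_edge) path \<Rightarrow>\<^sub>0 'k"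
  assume "x \<in> {basis_elt (fst h, orbit_path h (turns h)) - basis_elt (fst g, orbit_path g (turns g)) | h g.
    h \<in> arcs Q \<and> g \<in> arcs Q \<and> fst h = fst g \<and> h \<noteq> g}"
  then obtain h g where hg: "h \<in> arcs Q" "g \<in> arcs Q" "fst h = fst g" "h \<noteq> g"
    and x: "x = basis_elt (fst h, orbit_path h (turns h)) - basis_elt (fst g, orbit_path g (turns g))" by blast
  obtain i b where b: "h = (i, b)" "g = (i, \<not> b)" using hg(3,4) by (cases h; cases g) auto
  show "x \<in> relations_I \<G>"
    unfolding relations_I_def using hg(1,2)
    by (intro CollectI exI[of _ i] exI[of _ b]) (auto simp: x b special_power_eq, auto simp: arcs_Q)
qed

lemma relations_III_bex:
  "relations_III \<G> = {x. \<exists>a\<in>arcs Q. \<exists>b\<in>arcs Q. fst b = fst (\<sigma> a) \<and> b \<noteq> \<sigma> a \<and> x = basis_elt (fst a, [a, b])}"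
  unfolding relations_III_eq by blast

text \<open>If both half-edges of an edge are arrows, then relation (II) is a consequence of (I) and (III):
  multiplying the difference of the two special powers by the first arrow of one of them
  leaves, besides the path in (II), a path containing a product of two arrows as in (III).\<close>

lemma relation_II_redundant:
  fixes J :: "(('e, 'e half_edge) path \<Rightarrow>\<^sub>0 'k) set"
  assumes J: "ideal J (path_algebra Q)" "relations_III \<G> \<subseteq> J"
    and hg: "h \<in> arcs Q" "g \<in> arcs Q" "fst g = fst h" "g \<noteq> h"
    and d: "basis_elt (fst h, orbit_path h (turns h)) - basis_elt (fst g, orbit_path g (turns g)) \<in> J"
  shows "basis_elt (fst h, orbit_path h (Suc (turns h))) \<in> J"
proof -
  have "(fst h, [h]) \<in> paths Q"
    using awalk_orbit_path[OF hg(1), of 1] by (auto intro: pathsI)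
  then have "path_prod Q (fst h, orbit_path h (turns h)) (fst h, [h]) -
      path_prod Q (fst g, orbit_path g (turns g)) (fst h, [h]) \<in> J"
    using A.ideal_mult_right[OF J(1) d, of "basis_elt (fst h, [h])"]
    by (simp add: bilinear_ext_diff_left)
  then have "basis_elt (fst h, orbit_path h (Suc (turns h))) -
      basis_elt (fst g, orbit_path g (turns g) @ [h]) \<in> J"
    using awalk_special[OF hg(1)] awalk_special[OF hg(2)] hg(3)
    by (simp add: path_prod_def orbit_path_Suc' funpow_turns[OF hg(1)])
  moreover have "basis_elt (fst g, orbit_path g (turns g) @ [h]) \<in> J"
    using special_power_snoc_in_ideal[OF J hg(2,1)] hg(3,4) by simp
  ultimately show ?thesis using A.ideal_add[OF J(1)] by fastforce
qed

text \<open>Equality of generated ideals is tested against an arbitrary ideal J, the form in which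
  the consequences of (I) and (III) have been proved.\<close>

lemma I_eq_genideal:
  assumes S: "S \<subseteq> I"
    and rel: "\<And>J :: (('e, 'e half_edge) path \<Rightarrow>\<^sub>0 'k) set. \<lbrakk>ideal J (path_algebra Q); S \<subseteq> J\<rbrakk> \<Longrightarrow>
      relations_I \<G> \<subseteq> J \<and> relations_II \<G> \<subseteq> J \<and> relations_III \<G> \<subseteq> J"
  shows "I = Idl\<^bsub>path_algebra Q\<^esub> S"
proof
  show "Idl\<^bsub>path_algebra Q\<^esub> S \<subseteq> I" by (rule A.genideal_minimal[OF ideal_I S])
  have "S \<subseteq> carrier (path_algebra Q)" using S ideal.Icarr[OF ideal_I] by blast
  from rel[OF A.genideal_ideal[OF this] A.genideal_self[OF this]]
  show "I \<subseteq> Idl\<^bsub>path_algebra Q\<^esub> S"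
    unfolding I_def brauer_ideal_def
    by (intro A.genideal_minimal A.genideal_ideal \<open>S \<subseteq> carrier (path_algebra Q)\<close>) auto
qed

context
  fixes i
  assumes i: "arcs (graph \<G>) = {i}"
begin

lemma fst_arc: "h \<in> arcs Q \<Longrightarrow> fst h = i"
  using i by (simp add: arcs_Q)

lemma is_rose_Q: "is_rose Q i (arcs Q)"
  using i succ_arcs(1) by (auto simp: is_rose_def fst_arc)

lemma classification_no_arrow:
  assumes "arcs Q = {}"
  shows "is_rose Q i {}"
    and "algebra_isomorphic (quotient_algebra (path_algebra Q) I) (base_algebra :: ('k, 'k) module)"
proof -
  show rose: "is_rose Q i {}" using is_rose_Q assms by simp
  have "I = Idl\<^bsub>path_algebra Q\<^esub> {}"
    by (rule I_eq_genideal) (simp_all add: relations_I_eq relations_II_eq relations_III_eq assms)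
  then show "algebra_isomorphic (quotient_algebra (path_algebra Q) I) (base_algebra :: ('k, 'k) module)"
    using quotient_path_algebra_rose_empty[OF rose] by simp
qed

text \<open>A single arrow is fixed by \<open>\<sigma>\<close> and has no partner, so there are no
  relations (I) or (III). Relation (II) alone remains and gives the exponent
  \<open>turns \<alpha>\<close> + 1.\<close>

lemma classification_one_arrow:
  assumes \<alpha>: "arcs Q = {\<alpha>}"
  shows "is_rose Q i {\<alpha>}" "turns \<alpha> \<ge> 1"
    and "I = Idl\<^bsub>path_algebra Q\<^esub> {basis_elt (i, list_power (turns \<alpha> + 1) [\<alpha>])}"
    and "algebra_isomorphic (quotient_algebra (path_algebra Q) I)
      (quotient_algebra polynomial_algebra
        (Idl\<^bsub>polynomial_algebra\<^esub> {monom (1 :: 'k) (turns \<alpha> + 1)}))"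
proof -
  show rose: "is_rose Q i {\<alpha>}" using is_rose_Q \<alpha> by simp
  show "turns \<alpha> \<ge> 1" using turns_pos[of \<alpha>] \<alpha> by simp
  have fixed: "\<sigma> \<alpha> = \<alpha>" using succ_arcs(1)[of \<alpha>] \<alpha> by simp
  let ?s = "basis_elt (i, list_power (turns \<alpha> + 1) [\<alpha>]) :: _ \<Rightarrow>\<^sub>0 'k"
  have s: "?s = basis_elt (fst \<alpha>, orbit_path \<alpha> (Suc (turns \<alpha>)))"
    using fst_arc[of \<alpha>] by (simp add: orbit_path_fixed[OF fixed] \<alpha>)
  have "?s \<in> I" unfolding s by (rule relation_II_in_I) (simp add: \<alpha>)
  then show I: "I = Idl\<^bsub>path_algebra Q\<^esub> {?s}"
  proof (intro I_eq_genideal)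
    have "relations_I \<G> = ({} :: (_ \<Rightarrow>\<^sub>0 'k) set)" "relations_III \<G> = ({} :: (_ \<Rightarrow>\<^sub>0 'k) set)"
      unfolding relations_I_eq relations_III_bex \<alpha> using fixed by auto
    moreover have "relations_II \<G> = {?s}" unfolding relations_II_eq \<alpha> s by blast
    ultimately show "relations_I \<G> \<subseteq> J \<and> relations_II \<G> \<subseteq> J \<and> relations_III \<G> \<subseteq> J"
      if "{?s} \<subseteq> J" for J :: "(('e, 'e half_edge) path \<Rightarrow>\<^sub>0 'k) set"
      using that by simp
  qed simp
  have "{?s} \<subseteq> carrier (path_algebra Q)" using \<open>?s \<in> I\<close> ideal.Icarr[OF ideal_I] by blast
  from quotient_path_algebra_rose_one[OF rose this]
  show "algebra_isomorphic (quotient_algebra (path_algebra Q) I)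
      (quotient_algebra polynomial_algebra
        (Idl\<^bsub>polynomial_algebra\<^esub> {monom (1 :: 'k) (turns \<alpha> + 1)}))"
    unfolding I by (simp add: list_power_singleton rose_poly_basis del: replicate_Suc)
qed

text \<open>Relation (I) occurs with both signs, of which one is enough; (II) then follows for each
  arrow with the other one as partner.\<close>

lemma I_eq_two_arrows:
  assumes \<alpha>\<beta>: "arcs Q = {\<alpha>, \<beta>}" "\<alpha> \<noteq> \<beta>"
  shows "I = Idl\<^bsub>path_algebra Q\<^esub> (insert
    (basis_elt (i, orbit_path \<alpha> (turns \<alpha>)) - basis_elt (i, orbit_path \<beta> (turns \<beta>))) (relations_III \<G>))"
proof (rule I_eq_genideal)
  have fst: "fst \<alpha> = i" "fst \<beta> = i" using fst_arc \<alpha>\<beta> by simp_all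
  have rI: "relations_I \<G> = {basis_elt (i, orbit_path \<alpha> (turns \<alpha>)) - basis_elt (i, orbit_path \<beta> (turns \<beta>)),
      basis_elt (i, orbit_path \<beta> (turns \<beta>)) - basis_elt (i, orbit_path \<alpha> (turns \<alpha>)) :: _ \<Rightarrow>\<^sub>0 'k}"
  proof -
    have "relations_I \<G> = {x :: _ \<Rightarrow>\<^sub>0 'k. \<exists>h\<in>arcs Q. \<exists>g\<in>arcs Q. fst h = fst g \<and> h \<noteq> g \<and>
        x = basis_elt (fst h, orbit_path h (turns h)) - basis_elt (fst g, orbit_path g (turns g))}"
      unfolding relations_I_eq by blast
    also have "\<dots> = {x. x = basis_elt (i, orbit_path \<alpha> (turns \<alpha>)) - basis_elt (i, orbit_path \<beta> (turns \<beta>)) \<or>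
        x = basis_elt (i, orbit_path \<beta> (turns \<beta>)) - basis_elt (i, orbit_path \<alpha> (turns \<alpha>))}"
      by (simp add: \<alpha>\<beta> \<alpha>\<beta>(2)[symmetric] fst)
    finally show ?thesis by blast
  qed
  show "insert (basis_elt (i, orbit_path \<alpha> (turns \<alpha>)) - basis_elt (i, orbit_path \<beta> (turns \<beta>)))
      (relations_III \<G>) \<subseteq> I"
    using relations_subset(1,3) unfolding rI by blast
  fix J :: "(('e, 'e half_edge) path \<Rightarrow>\<^sub>0 'k) set"
  assume J: "ideal J (path_algebra Q)" and "insert (basis_elt (i, orbit_path \<alpha> (turns \<alpha>)) -
      basis_elt (i, orbit_path \<beta> (turns \<beta>))) (relations_III \<G>) \<subseteq> J"
  then have x: "basis_elt (i, orbit_path \<alpha> (turns \<alpha>)) - basis_elt (i, orbit_path \<beta> (turns \<beta>)) \<in> J"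
    and III: "relations_III \<G> \<subseteq> J" by auto
  have y: "basis_elt (i, orbit_path \<beta> (turns \<beta>)) - basis_elt (i, orbit_path \<alpha> (turns \<alpha>)) \<in> J"
    using A.ideal_diff[OF J A.ideal_zero[OF J] x] by simp
  have "basis_elt (fst \<alpha>, orbit_path \<alpha> (Suc (turns \<alpha>))) \<in> J"
    by (rule relation_II_redundant[OF J III, of _ \<beta>]) (use \<alpha>\<beta> x fst in simp_all)
  moreover have "basis_elt (fst \<beta>, orbit_path \<beta> (Suc (turns \<beta>))) \<in> J"
    by (rule relation_II_redundant[OF J III, of _ \<alpha>]) (use \<alpha>\<beta> y fst in simp_all)
  ultimately have "relations_II \<G> \<subseteq> J" unfolding relations_II_eq \<alpha>\<beta>(1) by blast
  with x y III show "relations_I \<G> \<subseteq> J \<and> relations_II \<G> \<subseteq> J \<and> relations_III \<G> \<subseteq> J"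
    unfolding rI by blast
qed

text \<open>Shared by both cases with two loops, which differ only in the words p, q, r, s.\<close>

lemma quotient_two_arrows_isomorphic:
  assumes \<alpha>\<beta>: "arcs Q = {\<alpha>, \<beta>}" "\<alpha> \<noteq> \<beta>" and I: "I = Idl\<^bsub>path_algebra Q\<^esub>
      {basis_elt (i, map (case_letter \<alpha> \<beta>) p) - basis_elt (i, map (case_letter \<alpha> \<beta>) q),
       basis_elt (i, map (case_letter \<alpha> \<beta>) r), basis_elt (i, map (case_letter \<alpha> \<beta>) s)}"
  shows "algebra_isomorphic (quotient_algebra (path_algebra Q) I)
    (quotient_algebra free_algebra (Idl\<^bsub>free_algebra\<^esub>
      {basis_elt r :: letter list \<Rightarrow>\<^sub>0 'k, basis_elt s, basis_elt p - basis_elt q}))"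
proof -
  have rose: "is_rose Q i {\<alpha>, \<beta>}" using is_rose_Q \<alpha>\<beta> by simp
  have paths: "(i, map (case_letter \<alpha> \<beta>) w) \<in> paths Q" for w
    by (auto simp: paths_rose[OF rose] split: letter.splits)
  let ?S = "{basis_elt (i, map (case_letter \<alpha> \<beta>) p) - basis_elt (i, map (case_letter \<alpha> \<beta>) q),
       basis_elt (i, map (case_letter \<alpha> \<beta>) r), basis_elt (i, map (case_letter \<alpha> \<beta>) s) :: _ \<Rightarrow>\<^sub>0 'k}"
  have S: "?S \<subseteq> carrier (path_algebra Q)"
  proof -
    have "Poly_Mapping.keys (basis_elt (i, map (case_letter \<alpha> \<beta>) p) -
        basis_elt (i, map (case_letter \<alpha> \<beta>) q) :: _ \<Rightarrow>\<^sub>0 'k) \<subseteq> paths Q"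
      by (rule order_trans[OF keys_diff]) (simp add: paths)
    then show ?thesis by (simp add: paths)
  qed
  let ?T = "Poly_Mapping.map_key (rose_path i \<alpha> \<beta>) :: (('e, 'e half_edge) path \<Rightarrow>\<^sub>0 'k) \<Rightarrow> _"
  note inj = inj_rose_path[OF \<alpha>\<beta>(2), of i]
  have basis: "?T (basis_elt (i, map (case_letter \<alpha> \<beta>) w)) = basis_elt w" for w
    using map_key_single[OF inj, of w 1] by (simp add: rose_path_def)
  have diff: "?T (f - g) = ?T f - ?T g" for f g
    using map_key_plus[OF inj, of "f - g" g] by (simp add: algebra_simps)
  have "?T ` ?S = {basis_elt r, basis_elt s, basis_elt p - basis_elt q}"
    by (simp add: basis diff insert_commute)
  then show ?thesis
    using quotient_path_algebra_rose_two[OF rose \<alpha>\<beta>(2) S] I by simp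
qed

text \<open>\<open>\<sigma>\<close> preserves endpoints, so it fixes both arrows and the mixed
  products are the relations (III). Exponent 1 is excluded because the endpoints are not
  truncated.\<close>

lemma classification_two_arrows_distinct:
  assumes \<alpha>\<beta>: "arcs Q = {\<alpha>, \<beta>}" "\<alpha> \<noteq> \<beta>" and ep: "ep \<alpha> \<noteq> ep \<beta>"
  shows "turns \<alpha> \<ge> 2" "turns \<beta> \<ge> 2"
    and "I = Idl\<^bsub>path_algebra Q\<^esub>
      {basis_elt (i, list_power (turns \<alpha>) [\<alpha>]) - basis_elt (i, list_power (turns \<beta>) [\<beta>]),
       basis_elt (i, [\<alpha>, \<beta>]), basis_elt (i, [\<beta>, \<alpha>])}"
    and "algebra_isomorphic (quotient_algebra (path_algebra Q) I)
      (quotient_algebra free_algebra (Idl\<^bsub>free_algebra\<^esub>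
        {basis_elt [X, Y] :: letter list \<Rightarrow>\<^sub>0 'k, basis_elt [Y, X],
         basis_elt (list_power (turns \<alpha>) [X]) - basis_elt (list_power (turns \<beta>) [Y])}))"
proof -
  have fst: "fst \<alpha> = i" "fst \<beta> = i" using fst_arc \<alpha>\<beta> by simp_all
  have fixed: "\<sigma> \<alpha> = \<alpha>" "\<sigma> \<beta> = \<beta>"
    using succ_arcs[of \<alpha>] succ_arcs[of \<beta>] ep \<alpha>\<beta>(1) by auto
  show "turns \<alpha> \<ge> 2" "turns \<beta> \<ge> 2"
    using turns_pos[of \<alpha>] turns_pos[of \<beta>] turns_neq_1[of \<alpha>] turns_neq_1[of \<beta>] \<alpha>\<beta>(1) by auto
  have III: "relations_III \<G> = {basis_elt (i, [\<alpha>, \<beta>]), basis_elt (i, [\<beta>, \<alpha>]) :: _ \<Rightarrow>\<^sub>0 'k}"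
    unfolding relations_III_bex by (auto simp: \<alpha>\<beta> \<alpha>\<beta>(2)[symmetric] fst fixed)
  show I: "I = Idl\<^bsub>path_algebra Q\<^esub>
      {basis_elt (i, list_power (turns \<alpha>) [\<alpha>]) - basis_elt (i, list_power (turns \<beta>) [\<beta>]),
       basis_elt (i, [\<alpha>, \<beta>]), basis_elt (i, [\<beta>, \<alpha>])}"
    using I_eq_two_arrows[OF \<alpha>\<beta>] by (simp add: III orbit_path_fixed fixed)
  show "algebra_isomorphic (quotient_algebra (path_algebra Q) I)
      (quotient_algebra free_algebra (Idl\<^bsub>free_algebra\<^esub>
        {basis_elt [X, Y] :: letter list \<Rightarrow>\<^sub>0 'k, basis_elt [Y, X],
         basis_elt (list_power (turns \<alpha>) [X]) - basis_elt (list_power (turns \<beta>) [Y])}))"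
    by (rule quotient_two_arrows_isomorphic[OF \<alpha>\<beta>]) (simp add: I map_list_power)
qed

text \<open>The common endpoint has valency 2 and \<open>\<sigma>\<close> swaps the arrows, so the
  squares are the relations (III), and special powers have length 2m.\<close>

lemma classification_two_arrows_same:
  assumes \<alpha>\<beta>: "arcs Q = {\<alpha>, \<beta>}" "\<alpha> \<noteq> \<beta>" and ep: "ep \<alpha> = ep \<beta>"
  defines "m \<equiv> multiplicity_at \<G> (ep \<alpha>)"
  shows "m \<ge> 1"
    and "I = Idl\<^bsub>path_algebra Q\<^esub>
      {basis_elt (i, list_power m [\<alpha>, \<beta>]) - basis_elt (i, list_power m [\<beta>, \<alpha>]),
       basis_elt (i, [\<alpha>, \<alpha>]), basis_elt (i, [\<beta>, \<beta>])}"
    and "algebra_isomorphic (quotient_algebra (path_algebra Q) I)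
      (quotient_algebra free_algebra (Idl\<^bsub>free_algebra\<^esub>
        {basis_elt [X, X] :: letter list \<Rightarrow>\<^sub>0 'k, basis_elt [Y, Y],
         basis_elt (list_power m [X, Y]) - basis_elt (list_power m [Y, X])}))"
proof -
  have fst: "fst \<alpha> = i" "fst \<beta> = i" using fst_arc \<alpha>\<beta> by simp_all
  have arcs: "\<alpha> \<in> arcs Q" "\<beta> \<in> arcs Q" by (simp_all add: \<alpha>\<beta>)
  show "m \<ge> 1" using multiplicity_pos[OF arcs(1)] by (simp add: m_def)
  have "{g \<in> arcs Q. ep g = ep \<alpha>} = {\<alpha>, \<beta>}" using \<alpha>\<beta>(1) ep by auto
  then have val: "val \<G> (ep \<alpha>) = 2" using val_eq_card[OF arcs(1)] \<alpha>\<beta>(2) by simp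
  obtain k where "k < 2" "\<beta> = (\<sigma> ^^ k) \<alpha>" using ex_funpow[OF arcs ep[symmetric]] val by auto
  with \<alpha>\<beta>(2) have swap1: "\<sigma> \<alpha> = \<beta>" by (cases k) auto
  have swap2: "\<sigma> \<beta> = \<alpha>" using funpow_val[OF arcs(1)] by (simp add: val numeral_2_eq_2 swap1)
  have III: "relations_III \<G> = {basis_elt (i, [\<alpha>, \<alpha>]), basis_elt (i, [\<beta>, \<beta>]) :: _ \<Rightarrow>\<^sub>0 'k}"
    unfolding relations_III_bex by (auto simp: \<alpha>\<beta> \<alpha>\<beta>(2)[symmetric] fst swap1 swap2)
  have turns: "turns \<alpha> = m * 2" "turns \<beta> = m * 2" using val ep by (simp_all add: turns_def m_def)
  show I: "I = Idl\<^bsub>path_algebra Q\<^esub>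
      {basis_elt (i, list_power m [\<alpha>, \<beta>]) - basis_elt (i, list_power m [\<beta>, \<alpha>]),
       basis_elt (i, [\<alpha>, \<alpha>]), basis_elt (i, [\<beta>, \<beta>])}"
    using I_eq_two_arrows[OF \<alpha>\<beta>]
    by (simp add: III turns orbit_path_swapped[OF swap1 swap2] orbit_path_swapped[OF swap2 swap1])
  show "algebra_isomorphic (quotient_algebra (path_algebra Q) I)
      (quotient_algebra free_algebra (Idl\<^bsub>free_algebra\<^esub>
        {basis_elt [X, X] :: letter list \<Rightarrow>\<^sub>0 'k, basis_elt [Y, Y],
         basis_elt (list_power m [X, Y]) - basis_elt (list_power m [Y, X])}))"
    by (rule quotient_two_arrows_isomorphic[OF \<alpha>\<beta>]) (simp add: I map_list_power)
qed

lemma arcs_Q_cases: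
  obtains "arcs Q = {}" | \<alpha> where "arcs Q = {\<alpha>}" | \<alpha> \<beta> where "arcs Q = {\<alpha>, \<beta>}" "\<alpha> \<noteq> \<beta>"
proof -
  have sub: "arcs Q \<subseteq> {(i, False), (i, True)}"
  proof
    fix h assume "h \<in> arcs Q"
    with fst_arc[of h] show "h \<in> {(i, False), (i, True)}" by (cases h) auto
  qed
  then have "arcs Q = {} \<or> arcs Q = {(i, False)} \<or> arcs Q = {(i, True)} \<or> arcs Q = {(i, False), (i, True)}"
    by blast
  then show thesis using that(1) that(2) that(3)[of "(i, False)" "(i, True)"] by auto
qed

end

end

theorem theorem5p3:
  fixes \<G> :: "('v, 'e) brauer_graph"
    and Q :: "('e, 'e half_edge) pre_digraph"
    and I :: "(('e, 'e half_edge) path \<Rightarrow>\<^sub>0 'k :: alg_closed_field) set"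
    and A :: "('k, (('e, 'e half_edge) path \<Rightarrow>\<^sub>0 'k) set) module"
  assumes "is_brauer_graph \<G>"
    and "Q = brauer_quiver \<G>"
    and "I = brauer_ideal \<G>"
    and "A = quotient_algebra (path_algebra Q) I"
  shows
    "(UMP Q I \<longleftrightarrow> is_single_edge (graph \<G>) \<or> is_single_loop (graph \<G>)) \<and>
     (is_single_edge (graph \<G>) \<or> is_single_loop (graph \<G>) \<longleftrightarrow>
       (\<exists>z. is_rose Q z {} \<and>
         algebra_isomorphic A (base_algebra :: ('k, 'k) module)) \<or>
       (\<exists>z \<alpha> m. is_rose Q z {\<alpha>} \<and> m \<ge> 1 \<and>
         I = Idl\<^bsub>path_algebra Q\<^esub> {basis_elt (z, list_power (m + 1) [\<alpha>])} \<and>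
         algebra_isomorphic A
           (quotient_algebra polynomial_algebra
             (Idl\<^bsub>polynomial_algebra\<^esub> {monom (1 :: 'k) (m + 1)}))) \<or>
       (\<exists>z \<alpha> \<beta> m n. \<alpha> \<noteq> \<beta> \<and> is_rose Q z {\<alpha>, \<beta>} \<and> m \<ge> 2 \<and> n \<ge> 2 \<and>
         I = Idl\<^bsub>path_algebra Q\<^esub>
           {basis_elt (z, list_power m [\<alpha>]) - basis_elt (z, list_power n [\<beta>]),
            basis_elt (z, [\<alpha>, \<beta>]), basis_elt (z, [\<beta>, \<alpha>])} \<and>
         algebra_isomorphic A
           (quotient_algebra free_algebra
             (Idl\<^bsub>free_algebra\<^esub>
               {basis_elt [X, Y] :: letter list \<Rightarrow>\<^sub>0 'k, basis_elt [Y, X],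
                basis_elt (list_power m [X]) - basis_elt (list_power n [Y])}))) \<or>
       (\<exists>z \<alpha> \<beta> m. \<alpha> \<noteq> \<beta> \<and> is_rose Q z {\<alpha>, \<beta>} \<and> m \<ge> 1 \<and>
         I = Idl\<^bsub>path_algebra Q\<^esub>
           {basis_elt (z, list_power m [\<alpha>, \<beta>]) - basis_elt (z, list_power m [\<beta>, \<alpha>]),
            basis_elt (z, [\<alpha>, \<alpha>]), basis_elt (z, [\<beta>, \<beta>])} \<and>
         algebra_isomorphic A
           (quotient_algebra free_algebra
             (Idl\<^bsub>free_algebra\<^esub>
               {basis_elt [X, X] :: letter list \<Rightarrow>\<^sub>0 'k, basis_elt [Y, Y],
                basis_elt (list_power m [X, Y]) - basis_elt (list_power m [Y, X])}))))"
proof -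
  interpret brauer_algebra \<G> I
    by unfold_locales (use assms in simp_all)
  note assms(2)[simp] assms(4)[simp]
  show ?thesis (is "_ \<and> (?two \<longleftrightarrow> ?a \<or> ?b \<or> ?c \<or> ?d)")
  proof (intro conjI iffI)
    assume ?two
    then obtain i where i: "arcs (graph \<G>) = {i}" using single_arc_iff by blast
    show "?a \<or> ?b \<or> ?c \<or> ?d"
    proof (cases rule: arcs_Q_cases[OF i])
      case 1
      then have ?a using classification_no_arrow[OF i] by auto
      then show ?thesis ..
    next
      case (2 \<alpha>)
      from classification_one_arrow[OF i this] have ?b
        unfolding assms(2,4) by (intro exI conjI)
      then show ?thesis by blast
    next
      case (3 \<alpha> \<beta>)
      have rose: "is_rose Q i {\<alpha>, \<beta>}" using is_rose_Q[OF i] 3 by simp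
      show ?thesis
      proof (cases "endpoint \<G> \<alpha> = endpoint \<G> \<beta>")
        case True
        from 3(2) rose classification_two_arrows_same[OF i 3 True] have ?d
          unfolding assms(2,4) by (intro exI conjI)
        then show ?thesis by blast
      next
        case False
        from 3(2) rose classification_two_arrows_distinct[OF i 3 False] have ?c
          unfolding assms(2,4) by (intro exI conjI)
        then show ?thesis by blast
      qed
    qed
  next
    assume "?a \<or> ?b \<or> ?c \<or> ?d"
    then obtain z L where "is_rose Q z L" by blast
    \<comment> \<open>The vertices of the quiver are the edges of the graph, so a one-vertex quiver
      means a single edge.\<close>
    then have "arcs (graph \<G>) = {z}" by (simp add: is_rose_def)
    then show ?two using single_arc_iff by blast
  qed (use UMP_iff in simp_all)
qed

end
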